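(* Let $(\mathcal X,d,\mu)$ be a doubling metric measure space with doubling exponent $n>0$ (see context). Let $s\in(0,\infty)$ and $p\in(0,\infty]$. (i) If $\sigma\in(0,p_\ast(s))$ (with $\sigma$ finite), then a measurable function $u$ satisfies $u\in\dot M^{s,p}(\mathcal X)$ if and only if $u^{\sharp,s}_\sigma\in L^p(\mathcal X)$, and moreover, for every $u\in\dot M^{s,p}(\mathcal X)$, $\|u\|_{\dot M^{s,p}(\mathcal X)}\sim\|u^{\sharp,s}_\sigma\|_{L^p(\mathcal X)}$, with constants independent of $u$. (ii) If $p\in(n/(n+s),\infty]$, then $\dot{\mathcal C}^{s,p}(\mathcal X)=\dot M^{s,p}(\mathcal X)$, with comparable (quasi-semi)norms.
   Context: Setting: $(\mathcal X,d)$ is a metric space and $\mu$ a regular Borel measure on $\mathcal X$ such that all balls have finite and positive measure, and $\mu$ is doubling: there exist constants $C_1>1$ and $n>0$ (fixed; $n$ is called the doubling exponent here) such that $\mu(B(x,\lambda r))\le C_1\lambda^n\mu(B(x,r))$ for all $x\in\mathcal X$, $r\in(0,\infty)$, $\lambda\in(1,\infty)$. Functions are real-valued; $⨍_E f\,d\mu=\frac1{\mu(E)}\int_E f\,d\mu$, $u_B=⨍_Bu\,d\mu$. For $s\in(0,\infty)$, $p\in(0,\infty]$: $p_\ast(s)=np/(n-ps)$ if $p<n/s$, and $p_\ast(s)=\infty$ if $p\ge n/s$. Fractional sharp maximal functions: $u^{\sharp,s}(x)=\sup_{t\in(0,\infty)}t^{-s}⨍_{B(x,t)}|u(z)-u_{B(x,t)}|\,d\mu(z)$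 for locally integrable (integrable on balls) $u$, and $u^{\sharp,s}_\sigma(x)=\sup_{t\in(0,\infty)}t^{-s}\inf_{c\in\mathbb R}\big(⨍_{B(x,t)}|u(z)-c|^\sigma\,d\mu(z)\big)^{1/\sigma}$. $\dot{\mathcal C}^{s,p}(\mathcal X)$ is the collection of all locally integrable functions $u$ with $\|u\|_{\dot{\mathcal C}^{s,p}(\mathcal X)}=\|u^{\sharp,s}\|_{L^p(\mathcal X)}<\infty$. Hajłasz-Sobolev space: for measurable $u$, $\mathcal D^s(u)$ is the set of all nonnegative measurable functions $g$ for which there is $E\subset\mathcal X$ with $\mu(E)=0$ such that $|u(x)-u(y)|\le[d(x,y)]^s[g(x)+g(y)]$ for all $x,y\in\mathcal X\setminus E$. $\dot M^{s,p}(\mathcal X)$ is the collection of all measurable $u$ with $\|u\|_{\dot M^{s,p}(\mathcal X)}=\inf_{g\in\mathcal D^s(u)}\|g\|_{L^p(\mathcal X)}<\infty$. *)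

theory Defs
  imports "HOL-Probability.Essential_Supremum"
begin

text \<open>
  The measure may live on a sigma-algebra larger than the Borel one (for instance its
  completion). Regularity is Borel regularity: every measurable set has a Borel hull of the
  same measure. Inner regularity with respect to compact sets is not assumed.
\<close>

locale doubling_metric_measure =
  fixes M :: "'a::metric_space measure" and C1 n :: real
  assumes borel_subset: "sets borel \<subseteq> sets M"
    and borel_regular: "A \<in> sets M \<Longrightarrow> \<exists>B\<in>sets borel. A \<subseteq> B \<and> emeasure M B = emeasure M A"
    and ball_pos: "0 < r \<Longrightarrow> 0 < emeasure M (ball x r)"
    and ball_finite: "0 < r \<Longrightarrow> emeasure M (ball x r) < \<infinity>"
    and C1_gt_1: "1 < C1"
    and n_pos: "0 < n"
    and doubling: "0 < r \<Longrightarrow> 1 < l \<Longrightarrow>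
      emeasure M (ball x (l * r)) \<le> ennreal (C1 * l powr n) * emeasure M (ball x r)"

text \<open>Powers with a positive exponent of elements of the extended half-line; for such
  exponents \<open>powr\<close> already gives the value 0 at 0.\<close>

definition enn_powr :: "ennreal \<Rightarrow> real \<Rightarrow> ennreal" where
  "enn_powr x a = (if x = \<infinity> then \<infinity> else ennreal (enn2real x powr a))"

definition Lp_norm :: "'a measure \<Rightarrow> ennreal \<Rightarrow> ('a \<Rightarrow> ennreal) \<Rightarrow> ennreal" where
  "Lp_norm M p f =
    (if p = \<infinity> then esssup M f
     else enn_powr (\<integral>\<^sup>+x. enn_powr (f x) (enn2real p) \<partial>M) (1 / enn2real p))"

definition Lp :: "'a measure \<Rightarrow> ennreal \<Rightarrow> ('a \<Rightarrow> ennreal) set" where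
  "Lp M p = {f \<in> borel_measurable M. Lp_norm M p f < \<infinity>}"

definition p_star :: "real \<Rightarrow> ennreal \<Rightarrow> real \<Rightarrow> ennreal" where
  "p_star n p s =
    (if p < ennreal (n / s) then ennreal (n * enn2real p / (n - enn2real p * s)) else \<infinity>)"

definition avg :: "'a measure \<Rightarrow> 'a set \<Rightarrow> ('a \<Rightarrow> real) \<Rightarrow> real" where
  "avg M E u = (LINT z:E|M. u z) / measure M E"

definition nn_avg :: "'a measure \<Rightarrow> 'a set \<Rightarrow> ('a \<Rightarrow> ennreal) \<Rightarrow> ennreal" where
  "nn_avg M E f = (\<integral>\<^sup>+z\<in>E. f z \<partial>M) / emeasure M E"

definition locally_integrable :: "'a::metric_space measure \<Rightarrow> ('a \<Rightarrow> real) \<Rightarrow> bool" where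
  "locally_integrable M u \<longleftrightarrow>
    u \<in> borel_measurable M \<and> (\<forall>x. \<forall>r>0. set_integrable M (ball x r) u)"

definition sharp :: "'a::metric_space measure \<Rightarrow> real \<Rightarrow> ('a \<Rightarrow> real) \<Rightarrow> 'a \<Rightarrow> ennreal" where
  "sharp M s u x = (SUP t\<in>{0<..}.
     ennreal (t powr (- s)) * nn_avg M (ball x t) (\<lambda>z. ennreal \<bar>u z - avg M (ball x t) u\<bar>))"

definition sharp_sigma ::
    "'a::metric_space measure \<Rightarrow> real \<Rightarrow> real \<Rightarrow> ('a \<Rightarrow> real) \<Rightarrow> 'a \<Rightarrow> ennreal" where
  "sharp_sigma M s \<sigma> u x = (SUP t\<in>{0<..}.
     ennreal (t powr (- s)) *
     (INF c. enn_powr (nn_avg M (ball x t) (\<lambda>z. ennreal (\<bar>u z - c\<bar> powr \<sigma>))) (1 / \<sigma>)))"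

definition C_norm :: "'a::metric_space measure \<Rightarrow> real \<Rightarrow> ennreal \<Rightarrow> ('a \<Rightarrow> real) \<Rightarrow> ennreal" where
  "C_norm M s p u = Lp_norm M p (sharp M s u)"

definition C_space :: "'a::metric_space measure \<Rightarrow> real \<Rightarrow> ennreal \<Rightarrow> ('a \<Rightarrow> real) set" where
  "C_space M s p = {u. locally_integrable M u \<and> sharp M s u \<in> Lp M p}"

definition hajlasz_gradients ::
    "'a::metric_space measure \<Rightarrow> real \<Rightarrow> ('a \<Rightarrow> real) \<Rightarrow> ('a \<Rightarrow> real) set" where
  "hajlasz_gradients M s u =
    {g \<in> borel_measurable M. (\<forall>x. 0 \<le> g x) \<and>
       (\<exists>E\<in>null_sets M. \<forall>x\<in>- E. \<forall>y\<in>- E. \<bar>u x - u y\<bar> \<le> dist x y powr s * (g x + g y))}"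

text \<open>If there is no gradient, the infimum is infinite.\<close>

definition hajlasz_norm ::
    "'a::metric_space measure \<Rightarrow> real \<Rightarrow> ennreal \<Rightarrow> ('a \<Rightarrow> real) \<Rightarrow> ennreal" where
  "hajlasz_norm M s p u = (INF g\<in>hajlasz_gradients M s u. Lp_norm M p (\<lambda>x. ennreal (g x)))"

definition hajlasz_space :: "'a::metric_space measure \<Rightarrow> real \<Rightarrow> ennreal \<Rightarrow> ('a \<Rightarrow> real) set" where
  "hajlasz_space M s p = {u \<in> borel_measurable M. hajlasz_norm M s p u < \<infinity>}"

definition comparable_on ::
    "'b set \<Rightarrow> ('b \<Rightarrow> ennreal) \<Rightarrow> ('b \<Rightarrow> ennreal) \<Rightarrow> bool" where
  "comparable_on S F G \<longleftrightarrow>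
    (\<exists>a b. 0 < a \<and> 0 < b \<and> (\<forall>u\<in>S. ennreal a * F u \<le> G u \<and> G u \<le> ennreal b * F u))"

end

theory Submission
  imports Defs
begin

text \<open>
  Put \<open>q = n \<sigma> / (n + \<sigma> s)\<close>, so that \<open>\<sigma>\<close> is the Sobolev exponent of \<open>q\<close>; the hypothesis on \<open>\<sigma>\<close> says
  exactly that \<open>q < p\<close>. A Sobolev-Poincare inequality bounds the sharp maximal function of \<open>u\<close> by
  the \<open>q\<close>-th root of the Hardy-Littlewood maximal function of \<open>g\<^sup>q\<close>, for every Hajlasz gradient \<open>g\<close>,
  and the maximal theorem in \<open>L\<^sup>p\<^sup>/\<^sup>q\<close> applies. Conversely, near-optimal constants on a shrinking
  sequence of balls around \<open>x\<close> converge geometrically to \<open>u x\<close> for almost every \<open>x\<close>, so a multiple of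
  the sharp maximal function is a Hajlasz gradient. Part (ii) is the case \<open>\<sigma> = 1\<close>, where the average
  is a near-optimal constant.
\<close>

section \<open>Covering\<close>

text \<open>Since \<open>u\<close> is merely measurable and \<sigma> may be below 1, neither
  averages of \<open>u\<close> nor the triangle inequality in the \<sigma>-norm nor Lebesgue
  differentiation is at hand. Constants are therefore compared through points: by Chebyshev,
  \<open>u\<close> is close to a near-optimal constant on most of the ball, and two exceptional sets
  of small relative measure leave a common good point. Differentiation is replaced by approximate
  continuity, which comes from the density theorem for preimages of rational intervals. The value of
  q is forced by scaling. A ball of radius comparable with r 2^(-q j / n) is too large to lie in the
  set where \<open>g\<close> exceeds A 2^j, so one can descend through the levels in steps of that
  size. The total cost is of order (g / A)^(1 - q s / n), and its \<sigma>-th power has to be the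
  q-th power of g / A. Each maximal function is a supremum over uncountably many radii; its
  measurability is obtained from closed sublevel sets.\<close>

lemma vitali_covering_balls:
  fixes a :: "'i \<Rightarrow> 'a::metric_space" and r :: "'i \<Rightarrow> real"
  assumes r: "\<And>i. i \<in> K \<Longrightarrow> 0 < r i \<and> r i \<le> R"
  obtains D where "D \<subseteq> K"
    "pairwise (\<lambda>i j. disjnt (ball (a i) (r i)) (ball (a j) (r j))) D"
    "(\<Union>i\<in>K. ball (a i) (r i)) \<subseteq> (\<Union>j\<in>D. ball (a j) (5 * r j))"
proof -
  define meets where "meets i j \<longleftrightarrow> \<not> disjnt (ball (a i) (r i)) (ball (a j) (r j))" for i j
  have sym: "meets i j \<longleftrightarrow> meets j i" for i j
    unfolding meets_def by (metis disjnt_sym)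
  \<comment> \<open>Maximal disjointness alone would not compare radii. The last condition does, and
    it survives both unions of chains and the insertion of a suitably large ball. Its factor 2
    yields the enlargement 1 + 2 * 2 = 5.\<close>
  define \<Omega> where "\<Omega> = {D. D \<subseteq> K \<and> (\<forall>i\<in>D. \<forall>j\<in>D. i \<noteq> j \<longrightarrow> \<not> meets i j) \<and>
     (\<forall>i\<in>K. (\<exists>j\<in>D. meets i j) \<longrightarrow> (\<exists>j\<in>D. meets i j \<and> r i \<le> 2 * r j))}"
  have "\<Union>C \<in> \<Omega>" if C: "subset.chain \<Omega> C" for C
  proof -
    have sub: "D \<in> \<Omega>" if "D \<in> C" for D
      using C that by (auto simp: subset_chain_def)
    have dj: "\<not> meets i j" if ij: "i \<in> \<Union>C" "j \<in> \<Union>C" "i \<noteq> j" for i j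
    proof -
      obtain D where "D \<in> C" "i \<in> D" "j \<in> D"
        using C ij by (auto simp: subset_chain_def) blast
      then show ?thesis
        using sub[of D] ij(3) by (auto simp: \<Omega>_def)
    qed
    have "\<exists>j\<in>\<Union>C. meets i j \<and> r i \<le> 2 * r j" if "i \<in> K" "j \<in> \<Union>C" "meets i j" for i j
    proof -
      obtain D where D: "D \<in> C" "j \<in> D" using \<open>j \<in> \<Union>C\<close> by blast
      then have "\<exists>j\<in>D. meets i j \<and> r i \<le> 2 * r j"
        using sub[of D] that by (auto simp: \<Omega>_def)
      then show ?thesis using D by blast
    qed
    moreover have "\<Union>C \<subseteq> K" using sub unfolding \<Omega>_def by blast
    ultimately show ?thesis using dj unfolding \<Omega>_def by blast
  qed
  then obtain D where D: "D \<in> \<Omega>" and max: "\<And>X. X \<in> \<Omega> \<Longrightarrow> D \<subseteq> X \<Longrightarrow> X = D"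
    using subset_Zorn'[of \<Omega>] by metis
  have DK: "D \<subseteq> K" and Ddj: "\<And>i j. i \<in> D \<Longrightarrow> j \<in> D \<Longrightarrow> i \<noteq> j \<Longrightarrow> \<not> meets i j"
    and Dp: "\<And>i j. i \<in> K \<Longrightarrow> j \<in> D \<Longrightarrow> meets i j \<Longrightarrow> \<exists>j\<in>D. meets i j \<and> r i \<le> 2 * r j"
    using D unfolding \<Omega>_def by blast+
  have all: "\<exists>j\<in>D. meets i j" if "i \<in> K" for i
  proof (rule ccontr)
    assume no: "\<not> (\<exists>j\<in>D. meets i j)"
    define N where "N = {i\<in>K. \<not> (\<exists>j\<in>D. meets i j)}"
    have iN: "i \<in> N" using no that by (auto simp: N_def)
    have bdd: "bdd_above (r ` N)" using r by (auto simp: N_def bdd_above_def)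
    have pos: "0 < Sup (r ` N)"
      using r[OF that] cSup_upper[OF _ bdd, of "r i"] iN by force
    \<comment> \<open>A ball whose radius exceeds half the supremum over \<open>N\<close> dominates
      every competitor in \<open>N\<close> up to the factor 2, so adding it stays within \<Omega>.
      Positivity of the supremum makes its half strictly smaller.\<close>
    then obtain k where k: "k \<in> N" "Sup (r ` N) / 2 < r k"
      using less_cSup_iff[OF _ bdd, of "Sup (r ` N) / 2"] iN by auto
    have big: "r i \<le> 2 * r k" if "i \<in> N" for i
      using cSup_upper[OF _ bdd, of "r i"] that k(2) by auto
    have kK: "k \<in> K" and kD: "\<And>j. j \<in> D \<Longrightarrow> \<not> meets k j" using k by (auto simp: N_def)
    have "insert k D \<in> \<Omega>"
      unfolding \<Omega>_def
    proof (intro CollectI conjI ballI impI)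
      show "insert k D \<subseteq> K" using DK kK by blast
      show "\<not> meets i j" if "i \<in> insert k D" "j \<in> insert k D" "i \<noteq> j" for i j
        using that Ddj kD sym by blast
      fix i assume i: "i \<in> K" "\<exists>j\<in>insert k D. meets i j"
      show "\<exists>j\<in>insert k D. meets i j \<and> r i \<le> 2 * r j"
      proof (cases "\<exists>j\<in>D. meets i j")
        case True then show ?thesis using Dp i(1) by blast
      next
        case False
        then have "i \<in> N" "meets i k" using i by (auto simp: N_def)
        then show ?thesis using big by blast
      qed
    qed
    then have "k \<in> D" using max by blast
    moreover have "meets k k"
      using r[OF kK] by (auto simp: meets_def disjnt_def)
    ultimately show False using kD by blast
  qed
  have "ball (a i) (r i) \<subseteq> (\<Union>j\<in>D. ball (a j) (5 * r j))" if i: "i \<in> K" for i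
  proof -
    obtain j where j: "j \<in> D" "meets i j" "r i \<le> 2 * r j"
      using all[OF i] Dp[OF i] by blast
    then obtain z where z: "dist (a i) z < r i" "dist (a j) z < r j"
      by (auto simp: meets_def disjnt_iff)
    have "dist (a j) w < 5 * r j" if "dist (a i) w < r i" for w
      using that z j(3) dist_triangle[of "a j" w z] dist_triangle[of z w "a i"]
      by (auto simp: dist_commute)
    then show ?thesis using j(1) by auto
  qed
  then show thesis
    using Ddj DK by (intro that[of D]) (auto simp: pairwise_def meets_def)
qed

text \<open>For each m, only finitely many members can carry more than 1 / (m + 1), because their
  integrals add up to at most that of \<open>h\<close>. This makes a selected family of disjoint
  balls countable without any appeal to separability of the space.\<close>

lemma countable_disjoint_dominated:
  fixes h :: "'a \<Rightarrow> ennreal"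
  assumes h: "h \<in> borel_measurable M" "(\<integral>\<^sup>+x. h x \<partial>M) < \<infinity>"
    and A: "\<And>i. i \<in> D \<Longrightarrow> A i \<in> sets M" "disjoint_family_on A D"
    and pos: "\<And>i. i \<in> D \<Longrightarrow> 0 < (\<integral>\<^sup>+x\<in>A i. h x \<partial>M)"
  shows "countable D"
proof -
  let ?c = "\<lambda>i. \<integral>\<^sup>+x\<in>A i. h x \<partial>M"
  have fin: "finite {i\<in>D. 1 / of_nat (Suc m) < ?c i}" for m
  proof (rule ccontr)
    let ?S = "{i\<in>D. 1 / of_nat (Suc m) < ?c i}"
    assume inf: "infinite ?S"
    obtain I where I: "0 \<le> I" "(\<integral>\<^sup>+x. h x \<partial>M) = ennreal I"
      using h(2) by (cases "\<integral>\<^sup>+x. h x \<partial>M") auto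
    obtain N :: nat where N: "I * real (Suc m) < real N" using reals_Archimedean2 by blast
    obtain F where F: "F \<subseteq> ?S" "finite F" "card F = N"
      using infinite_arbitrarily_large[OF inf] by blast
    have "ennreal (real N / real (Suc m)) = (\<Sum>i\<in>F. 1 / of_nat (Suc m))"
      using F by (simp add: ennreal_of_nat_eq_real_of_nat[symmetric] divide_ennreal[symmetric] 
         ennreal_times_divide)
    also have "\<dots> \<le> (\<Sum>i\<in>F. ?c i)"
      using F by (intro sum_mono) auto
    also have "\<dots> = (\<integral>\<^sup>+x. (\<Sum>i\<in>F. h x * indicator (A i) x) \<partial>M)"
      using F A(1) h(1) by (subst nn_integral_sum) (auto intro!: borel_measurable_times_ennreal)
    also have "\<dots> \<le> (\<integral>\<^sup>+x. h x \<partial>M)"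
    proof (rule nn_integral_mono)
      fix x
      have "disjoint_family_on A F" using A(2) F by (auto simp: disjoint_family_on_def)
      then have "(\<Sum>i\<in>F. h x * indicator (A i) x) = h x * indicator (\<Union>i\<in>F. A i) x"
        using F(2) by (simp add: indicator_UN_disjoint sum_distrib_left)
      then show "(\<Sum>i\<in>F. h x * indicator (A i) x) \<le> h x"
        by (simp add: indicator_def)
    qed
    also have "\<dots> = ennreal I" by (rule I)
    finally have "real N / real (Suc m) \<le> I" using I(1) by simp
    then show False using N by (simp add: field_simps)
  qed
  have "\<exists>m. 1 / of_nat (Suc m) < ?c i" if "i \<in> D" for i
  proof (cases "?c i")
    case (real v)
    then have "0 < v" using pos[OF that] by (simp add: ennreal_less_zero_iff)
    then obtain m where "inverse (real (Suc m)) < v" using reals_Archimedean by blast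
    then have "ennreal (1 / real (Suc m)) < ?c i"
      using real by (simp add: ennreal_less_iff inverse_eq_divide)
    then show ?thesis
      by (metis divide_ennreal ennreal_1 ennreal_of_nat_eq_real_of_nat of_nat_0_less_iff zero_le_one zero_less_Suc)
  next
    case top
    have "1 / of_nat (Suc 0) < (top::ennreal)" by simp
    then show ?thesis using top by metis
  qed
  then have "D \<subseteq> (\<Union>m. {i\<in>D. 1 / of_nat (Suc m) < ?c i})" by blast
  then show ?thesis
    using fin by (meson countable_UN countable_finite countable_subset countableI_type)
qed

section \<open>Balls in the doubling space and a covering inequality\<close>

context doubling_metric_measure begin

lemma space_M [simp]: "space M = UNIV"
  using borel_subset sets.sets_into_space[of UNIV M] by (auto simp: subset_eq)

lemma borel_in_M: "A \<in> sets borel \<Longrightarrow> A \<in> sets M"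
  using borel_subset by blast

lemma open_in_M: "open A \<Longrightarrow> A \<in> sets M"
  by (simp add: borel_in_M)

lemma ball_in_M [measurable, simp]: "ball x r \<in> sets M"
  by (simp add: open_in_M)

lemma ball_nonzero: "0 < r \<Longrightarrow> emeasure M (ball x r) \<noteq> 0" 
  and ball_not_top: "emeasure M (ball x r) \<noteq> \<infinity>"
  using ball_pos[of r x] ball_finite[of r x] by (auto simp: less_top) (cases "0 < r"; force simp: ball_empty)

lemma ball_measure_pos: "0 < r \<Longrightarrow> 0 < measure M (ball x r)"
  using ball_nonzero[of r x] ball_not_top[of x r] 
  by (metis emeasure_eq_ennreal_measure ennreal_0 infinity_ennreal_def measure_nonneg order_le_imp_less_or_eq)

lemma emeasure_ball: "emeasure M (ball x r) = ennreal (measure M (ball x r))"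
  using ball_not_top by (simp add: emeasure_eq_ennreal_measure)

lemma doubling_real:
  assumes "0 < r" "1 < l"
  shows "measure M (ball x (l * r)) \<le> C1 * l powr n * measure M (ball x r)"
  using doubling[OF assms, of x] C1_gt_1
  by (simp add: emeasure_ball ennreal_mult''[symmetric])

text \<open>For a selected ball B, doubling bounds the measure of 5B by \<open>C1 * 5 powr n\<close>
  times that of B, which is at most the integral of \<open>h\<close> over B; disjointness sums these
  integrals. With \<open>h\<close> a multiple of an indicator this yields density points, with
  \<open>h\<close> equal to \<open>f / c\<close> the weak type bound.\<close>

lemma vitali_measure:
  assumes h: "h \<in> borel_measurable M"
    and K: "\<And>x r. (x, r) \<in> K \<Longrightarrow> 0 < r \<and> r \<le> R"
    and dom: "\<And>x r. (x, r) \<in> K \<Longrightarrow> emeasure M (ball x r) \<le> (\<integral>\<^sup>+z\<in>ball x r. h z \<partial>M)"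
  shows "emeasure M (\<Union>(x, r)\<in>K. ball x r) \<le> ennreal (C1 * 5 powr n) * (\<integral>\<^sup>+z. h z \<partial>M)"
proof (cases "(\<integral>\<^sup>+z. h z \<partial>M) = \<infinity>")
  case True
  have "0 < C1 * 5 powr n" using C1_gt_1 by simp
  then have "ennreal (C1 * 5 powr n) * (\<integral>\<^sup>+z. h z \<partial>M) = \<infinity>"
    using True by (auto simp: ennreal_mult_top ennreal_mult_eq_top_iff)
  then show ?thesis by simp
next
  case False
  have K': "0 < snd i \<and> snd i \<le> R" "emeasure M (ball (fst i) (snd i)) \<le> (\<integral>\<^sup>+z\<in>ball (fst i) (snd i). h z \<partial>M)"
    if "i \<in> K" for i
    using K[of "fst i" "snd i"] dom[of "fst i" "snd i"] that by auto
  obtain D where D: "D \<subseteq> K"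
    "pairwise (\<lambda>i j. disjnt (ball (fst i) (snd i)) (ball (fst j) (snd j))) D"
    "(\<Union>i\<in>K. ball (fst i) (snd i)) \<subseteq> (\<Union>j\<in>D. ball (fst j) (5 * snd j))"
    using vitali_covering_balls[of K snd R fst, OF K'(1)] by blast
  let ?B = "\<lambda>i. ball (fst i) (snd i)"
  have dj: "disjoint_family_on ?B D"
    using D(2) by (auto simp: disjoint_family_on_def pairwise_def disjnt_def)
  have Dr: "0 < snd i" "emeasure M (?B i) \<le> (\<integral>\<^sup>+z\<in>?B i. h z \<partial>M)"
    if "i \<in> D" for i
    using K'[of i] that D(1) by auto
  \<comment> \<open>Finiteness of the integral of \<open>h\<close> enters here, which is why the
    infinite case was split off.\<close>
  have cD: "countable D"
  proof (rule countable_disjoint_dominated[OF h])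
    show "0 < (\<integral>\<^sup>+z\<in>?B i. h z \<partial>M)" if "i \<in> D" for i
      using Dr[OF that] ball_pos order_less_le_trans by blast
  qed (use False dj in \<open>auto simp: less_top\<close>)
  have sig: "emeasure M (ball x (5 * r)) \<le> ennreal (C1 * 5 powr n) * emeasure M (ball x r)" if "0 < r" for x r
    using doubling[OF that, of 5 x] by simp
  have "emeasure M (\<Union>(x, r)\<in>K. ball x r) \<le> emeasure M (\<Union>j\<in>D. ball (fst j) (5 * snd j))"
    using D(3) by (intro emeasure_mono open_in_M) (auto simp: case_prod_unfold)
  also have "\<dots> = (\<integral>\<^sup>+z. indicator (\<Union>j\<in>D. ball (fst j) (5 * snd j)) z \<partial>M)"
    by (rule nn_integral_indicator[symmetric]) (auto intro: open_in_M)
  \<comment> \<open>The sum over \<open>D\<close> is an integral against counting measure, so that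
    countability of \<open>D\<close> is all that the exchange with the integral over
    \<open>M\<close> requires.\<close>
  also have "\<dots> \<le> (\<integral>\<^sup>+z. (\<integral>\<^sup>+j. indicator (ball (fst j) (5 * snd j)) z \<partial>count_space D) \<partial>M)"
  proof (rule nn_integral_mono)
    fix z
    show "indicator (\<Union>j\<in>D. ball (fst j) (5 * snd j)) z \<le>
        (\<integral>\<^sup>+j. indicator (ball (fst j) (5 * snd j)) z \<partial>count_space D)"
    proof (cases "z \<in> (\<Union>j\<in>D. ball (fst j) (5 * snd j))")
      case True
      then obtain j where j: "j \<in> D" "z \<in> ball (fst j) (5 * snd j)" by blast
      then have "(\<integral>\<^sup>+i. indicator {j} i \<partial>count_space D) = 1" by simp
      moreover have "(\<integral>\<^sup>+i. indicator {j} i \<partial>count_space D) \<le>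
          (\<integral>\<^sup>+i. indicator (ball (fst i) (5 * snd i)) z \<partial>count_space D)"
        using j by (intro nn_integral_mono) (auto simp: indicator_def)
      ultimately show ?thesis by (simp add: indicator_def)
    qed (simp add: indicator_def)
  qed
  also have "\<dots> = (\<integral>\<^sup>+j. emeasure M (ball (fst j) (5 * snd j)) \<partial>count_space D)"
    using cD by (subst nn_integral_count_space_nn_integral) auto
  also have "\<dots> \<le> (\<integral>\<^sup>+j. ennreal (C1 * 5 powr n) * (\<integral>\<^sup>+z\<in>?B j. h z \<partial>M) \<partial>count_space D)"
    by (intro nn_integral_mono) (simp add: order_trans[OF sig[OF Dr(1)] mult_left_mono[OF Dr(2)]])
  also have "\<dots> = ennreal (C1 * 5 powr n) * (\<integral>\<^sup>+j. (\<integral>\<^sup>+z\<in>?B j. h z \<partial>M) \<partial>count_space D)"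
    by (rule nn_integral_cmult) auto
  also have "(\<integral>\<^sup>+j. (\<integral>\<^sup>+z\<in>?B j. h z \<partial>M) \<partial>count_space D) = (\<integral>\<^sup>+z\<in>(\<Union>j\<in>D. ?B j). h z \<partial>M)"
  proof -
    have U: "(\<Union>j\<in>D. ?B j) \<in> sets M" by (auto intro: open_in_M)
    have "emeasure (density M h) (\<Union>j\<in>D. ?B j) = (\<integral>\<^sup>+j. emeasure (density M h) (?B j) \<partial>count_space D)"
      by (rule emeasure_UN_countable[OF _ cD dj]) simp
    then show ?thesis
      by (simp only: emeasure_density[OF h(1) U] emeasure_density[OF h(1) ball_in_M])
  qed
  also have "\<dots> \<le> (\<integral>\<^sup>+z. h z \<partial>M)"
    by (intro nn_integral_mono) (auto simp: indicator_def)
  finally show ?thesis by (simp add: mult_left_mono)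
qed

end

section \<open>Density points\<close>

text \<open>Induction over the generation of the Borel sets. Approximation from inside and outside
  is carried together because complements exchange the two. Intersecting with \<open>S\<close> of
  finite measure gives continuity from above even if \<open>M\<close> is infinite.\<close>

lemma borel_approx_open_closed:
  fixes M :: "'a::metric_space measure"
  assumes M: "sets borel \<subseteq> sets M" and S: "S \<in> sets M" "emeasure M S < \<infinity>"
    and A: "A \<in> sets borel" and e: "0 < e"
  shows "\<exists>U C. open U \<and> closed C \<and> C \<subseteq> A \<and> A \<subseteq> U \<and> emeasure M ((U - C) \<inter> S) \<le> ennreal e"
proof -
  have op: "V \<in> sets M" if "open V" for V using M that by auto
  have cl: "V \<in> sets M" if "closed V" for V using M that by auto
  have small: "\<exists>k. emeasure M (D k \<inter> S) < c"
    if D: "\<And>k. D k \<in> sets M" "decseq D" and lim: "emeasure M ((\<Inter>k. D k) \<inter> S) < c" for D :: "nat \<Rightarrow> 'a set" and c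
  proof -
    have "(\<lambda>k. emeasure M (D k \<inter> S)) \<longlonglongrightarrow> emeasure M (\<Inter>k. D k \<inter> S)"
    proof (rule Lim_emeasure_decseq)
      show "decseq (\<lambda>k. D k \<inter> S)" using D(2) by (auto simp: decseq_def)
      show "emeasure M (D k \<inter> S) \<noteq> \<infinity>" for k
        using S emeasure_mono[of "D k \<inter> S" S M] by (auto simp: top_unique less_top)
    qed (use D S in auto)
    moreover have "(\<Inter>k. D k \<inter> S) = (\<Inter>k. D k) \<inter> S" by auto
    ultimately have "\<forall>\<^sub>F k in sequentially. emeasure M (D k \<inter> S) < c"
      using lim by (simp add: order_tendstoD)
    then show ?thesis by (auto simp: eventually_sequentially)
  qed
  have "A \<in> sigma_sets UNIV {S. open S}"
    using A by (simp add: borel_def)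
  then show ?thesis using e
  proof (induction arbitrary: e)
    case (Basic A)
    then have "open A" by simp
    \<comment> \<open>\<open>C k\<close> consists of the points of distance at least 1 / (k + 1)
      from everything outside \<open>A\<close>; an open set is the increasing union of these closed
      sets.\<close>
    define C where "C k = - (\<Union>x\<in>-A. ball x (1 / real (Suc k)))" for k
    have C: "closed (C k)" "C k \<subseteq> A" for k
    proof -
      show "closed (C k)" unfolding C_def by auto
      have "x \<in> (\<Union>x\<in>-A. ball x (1 / real (Suc k)))" if "x \<notin> A" for x
        using that by (intro UN_I[of x]) auto
      then show "C k \<subseteq> A" unfolding C_def by blast
    qed
    have "x \<in> (\<Union>k. C k)" if xA: "x \<in> A" for x
    proof -
      obtain d where d: "0 < d" "ball x d \<subseteq> A" by (rule openE[OF \<open>open A\<close> xA])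
      obtain k where "inverse (real (Suc k)) < d" using reals_Archimedean[OF d(1)] by blast
      then have k: "1 / real (Suc k) < d" by (simp only: inverse_eq_divide)
      have "x \<notin> ball y (1 / real (Suc k))" if "y \<notin> A" for y
      proof
        assume "x \<in> ball y (1 / real (Suc k))"
        then have "y \<in> ball x d" using k by (simp only: mem_ball dist_commute)
        then show False using that d(2) by blast
      qed
      then have "x \<in> C k" unfolding C_def by blast
      then show ?thesis by blast
    qed
    then have empty: "(\<Inter>k. A - C k) = {}" by blast
    have "emeasure M ((\<Inter>k. A - C k) \<inter> S) < ennreal e"
      unfolding empty using \<open>0 < e\<close> by simp
    moreover have "decseq (\<lambda>k. A - C k)"
    proof (rule decseq_SucI)
      fix k
      have "1 / real (Suc (Suc k)) \<le> 1 / real (Suc k)" by (simp add: frac_le)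
      then have "ball x (1 / real (Suc (Suc k))) \<subseteq> ball x (1 / real (Suc k))" for x :: 'a
        by (rule subset_ball)
      then have "C k \<subseteq> C (Suc k)" unfolding C_def by blast
      then show "A - C (Suc k) \<subseteq> A - C k" by blast
    qed
    ultimately obtain k where "emeasure M ((A - C k) \<inter> S) < ennreal e"
      using small[of "\<lambda>k. A - C k" "ennreal e"] op[OF \<open>open A\<close>] cl[OF C(1)] by blast
    then show ?case using \<open>open A\<close> C[of k] by (intro exI[of _ A] exI[of _ "C k"]) auto
  next
    case Empty
    show ?case by (rule exI[of _ "{}"]) (use Empty in auto)
  next
    case (Compl A)
    then obtain U C where UC: "open U" "closed C" "C \<subseteq> A" "A \<subseteq> U" "emeasure M ((U - C) \<inter> S) \<le> ennreal e"
      using Compl.IH[OF Compl.prems] by (elim exE conjE)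
    have "- C - - U = U - C" by blast
    then show ?case
      using UC by (intro exI[of _ "- C"] exI[of _ "- U"]) auto
  next
    case (Union A)
    \<comment> \<open>These errors add up to \<open>e / 2\<close>. The strict gap to
      \<open>e\<close> is spent on replacing infinitely many closed sets by finitely many.\<close>
    have "\<exists>U C. open U \<and> closed C \<and> C \<subseteq> A i \<and> A i \<subseteq> U \<and> emeasure M ((U - C) \<inter> S) \<le> ennreal (e / 2 * (1/2) ^ Suc i)" for i
      using Union by simp
    then obtain U C where UC: "\<And>i. open (U i)" "\<And>i. closed (C i)" "\<And>i. C i \<subseteq> A i" "\<And>i. A i \<subseteq> U i"
      and m: "\<And>i. emeasure M ((U i - C i) \<inter> S) \<le> ennreal (e / 2 * (1/2) ^ Suc i)"
      by metis
    \<comment> \<open>A countable union of closed sets need not be closed, so only finite unions are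
      removed; \<open>D k\<close> decreases with \<open>k\<close>, and continuity from above finds a
      good index.\<close>
    define D where "D k = (\<Union>i. U i) - (\<Union>i\<le>k. C i)" for k :: nat
    have "(\<Inter>k. D k) \<inter> S \<subseteq> (\<Union>i. (U i - C i) \<inter> S)"
    proof
      fix x assume x: "x \<in> (\<Inter>k. D k) \<inter> S"
      then have "x \<in> D k" for k by blast
      then have "x \<in> (\<Union>i. U i)" "x \<notin> C k" for k unfolding D_def by blast+
      then show "x \<in> (\<Union>i. (U i - C i) \<inter> S)" using x by blast
    qed
    moreover have "(\<Union>i. (U i - C i) \<inter> S) \<in> sets M"
      using UC op cl S by (intro sets.countable_UN) auto
    ultimately have "emeasure M ((\<Inter>k. D k) \<inter> S) \<le> emeasure M (\<Union>i. (U i - C i) \<inter> S)"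
      by (rule emeasure_mono)
    also have "\<dots> \<le> (\<Sum>i. emeasure M ((U i - C i) \<inter> S))"
      using UC op cl S by (intro emeasure_subadditive_countably) auto
    also have "\<dots> \<le> (\<Sum>i. ennreal (e / 2 * (1/2) ^ Suc i))"
      by (rule suminf_le[OF m]) auto
    also have "\<dots> = ennreal (e / 2 * 1)"
      using \<open>0 < e\<close> by (intro suminf_ennreal_eq sums_mult power_half_series) auto
    also have "\<dots> < ennreal e" using \<open>0 < e\<close> by (simp add: ennreal_less_iff)
    finally have "emeasure M ((\<Inter>k. D k) \<inter> S) < ennreal e" .
    moreover have "D k \<in> sets M" for k
      unfolding D_def using UC op cl by (intro sets.Diff op open_UN cl closed_UN) auto
    moreover have "decseq D"
      unfolding D_def decseq_def by force
    ultimately obtain k where "emeasure M (D k \<inter> S) < ennreal e"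
      using small by blast
    moreover have "open (\<Union>i. U i)" "closed (\<Union>i\<le>k. C i)"
      using UC(1,2) by (auto intro: closed_UN)
    moreover have "(\<Union>i\<le>k. C i) \<subseteq> (\<Union>i. A i)" "(\<Union>i. A i) \<subseteq> (\<Union>i. U i)"
      using UC(3,4) by blast+
    ultimately show ?case
      unfolding D_def by (metis less_imp_le)
  qed
qed

context doubling_metric_measure begin

text \<open>A set of the possibly larger sigma-algebra is first replaced by a Borel hull of equal
  measure. Because that measure is finite, the hull exceeds \<open>A\<close> by a null set only, and
  an open approximation of the hull serves for \<open>A\<close>.\<close>

lemma outer_regular_bounded:
  assumes A: "A \<in> sets M" "A \<subseteq> ball a R" and e: "0 < e"
  shows "\<exists>U. open U \<and> A \<subseteq> U \<and> U \<subseteq> ball a R \<and> emeasure M (U - A) \<le> ennreal e"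
proof -
  obtain B where B: "B \<in> sets borel" "A \<subseteq> B" "emeasure M B = emeasure M A"
    using borel_regular[OF A(1)] by blast
  have fin: "emeasure M A \<noteq> \<infinity>"
    using ball_not_top[of a R] emeasure_mono[OF A(2), of M] by (auto simp: top_unique)
  obtain U C where UC: "open U" "closed C" "C \<subseteq> B" "B \<subseteq> U" "emeasure M ((U - C) \<inter> ball a R) \<le> ennreal e"
    using borel_approx_open_closed[OF borel_subset ball_in_M _ B(1) e, of a R] ball_not_top[of a R]
    by (auto simp: less_top)
  have sets: "U \<in> sets M" "C \<in> sets M" "B \<in> sets M"
    using UC B(1) by (auto intro: borel_in_M)
  have "emeasure M (B - A) = 0"
    using B fin by (subst emeasure_Diff) (auto simp: A sets)
  then have "B - A \<in> null_sets M" using sets A by auto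
  have "emeasure M (U \<inter> ball a R - A) \<le> emeasure M (((U - C) \<inter> ball a R) \<union> (B - A))"
    using sets A UC by (intro emeasure_mono) auto
  also have "\<dots> = emeasure M ((U - C) \<inter> ball a R)"
    using \<open>B - A \<in> null_sets M\<close> sets by (intro emeasure_Un_null_set) auto
  also have "\<dots> \<le> ennreal e" by (rule UC)
  finally show ?thesis
    using UC A B by (intro exI[of _ "U \<inter> ball a R"]) auto
qed

text \<open>Take an open \<open>U\<close> around the bounded piece with \<open>U - A\<close> of
  measure at most 1 / (m + 1). Each bad point has a small ball inside \<open>U\<close> on which the
  indicator of \<open>U - A\<close>, divided by \<delta>, has average at least 1, so the covering
  inequality bounds the union of these balls by a multiple of 1 / (m + 1). The bad set itself is not
  shown to be measurable, hence the null superset \<open>W\<close>.\<close>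

lemma density_bad_set_null:
  assumes A: "A \<in> sets M" and \<delta>: "0 < \<delta>"
  shows "\<exists>W\<in>null_sets M. {x \<in> A \<inter> ball a R. \<forall>r0>0. \<exists>r. 0 < r \<and> r < r0 \<and>
      ennreal \<delta> * emeasure M (ball x r) \<le> emeasure M (ball x r - A)} \<subseteq> W" (is "\<exists>W\<in>_. ?Bad \<subseteq> W")
proof -
  let ?c = "C1 * 5 powr n / \<delta>"
  have "\<exists>W. W \<in> sets M \<and> ?Bad \<subseteq> W \<and> emeasure M W \<le> ennreal (?c * inverse (real (Suc m)))" for m
  proof -
    obtain U where U: "open U" "A \<inter> ball a R \<subseteq> U" "U \<subseteq> ball a R"
      "emeasure M (U - A \<inter> ball a R) \<le> ennreal (inverse (real (Suc m)))"
      using outer_regular_bounded[of "A \<inter> ball a R" a R "inverse (real (Suc m))"] A by auto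
    have UA: "U - A \<inter> ball a R = U - A" using U(3) by auto
    define K where "K = {(x, r). 0 < r \<and> r \<le> 1 \<and> ball x r \<subseteq> U \<and>
      ennreal \<delta> * emeasure M (ball x r) \<le> emeasure M (ball x r - A)}"
    define h where "h z = ennreal (1 / \<delta>) * indicator (U - A) z" for z
    have [measurable]: "U - A \<in> sets M" using U(1) A by (auto intro: open_in_M)
    have hm: "h \<in> borel_measurable M" unfolding h_def by measurable
    have h_int: "(\<integral>\<^sup>+z\<in>V. h z \<partial>M) = ennreal (1 / \<delta>) * emeasure M (V \<inter> (U - A))" if "V \<in> sets M" for V
    proof -
      have "(\<integral>\<^sup>+z\<in>V. h z \<partial>M) = (\<integral>\<^sup>+z. ennreal (1 / \<delta>) * indicator (V \<inter> (U - A)) z \<partial>M)"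
        unfolding h_def by (intro nn_integral_cong) (auto simp: indicator_def)
      then show ?thesis using that by (simp add: nn_integral_cmult_indicator)
    qed
    have "emeasure M (\<Union>(x, r)\<in>K. ball x r) \<le> ennreal (C1 * 5 powr n) * (\<integral>\<^sup>+z. h z \<partial>M)"
    proof (rule vitali_measure[OF hm])
      show "0 < r \<and> r \<le> 1" if "(x, r) \<in> K" for x r using that by (auto simp: K_def)
      show "emeasure M (ball x r) \<le> (\<integral>\<^sup>+z\<in>ball x r. h z \<partial>M)" if "(x, r) \<in> K" for x r
      proof -
        have "ball x r \<inter> (U - A) = ball x r - A" using that by (auto simp: K_def)
        moreover have "ennreal (1 / \<delta>) * (ennreal \<delta> * emeasure M (ball x r)) \<le> ennreal (1 / \<delta>) * emeasure M (ball x r - A)"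
          using that by (intro mult_left_mono) (auto simp: K_def)
        moreover have "ennreal (1 / \<delta>) * (ennreal \<delta> * emeasure M (ball x r)) = emeasure M (ball x r)"
          using \<delta> by (simp add: mult.assoc[symmetric] ennreal_mult[symmetric])
        ultimately show ?thesis by (simp add: h_int)
      qed
    qed
    also have "(\<integral>\<^sup>+z. h z \<partial>M) = ennreal (1 / \<delta>) * emeasure M (U - A)"
      using h_int[of UNIV] borel_in_M by simp
    also have "ennreal (C1 * 5 powr n) * \<dots> \<le> ennreal (C1 * 5 powr n) * (ennreal (1 / \<delta>) * ennreal (inverse (real (Suc m))))"
      using U(4) UA by (intro mult_left_mono) auto
    also have "\<dots> = ennreal (?c * inverse (real (Suc m)))"
      using \<delta> C1_gt_1 by (simp add: ennreal_mult[symmetric])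
    finally have le: "emeasure M (\<Union>(x, r)\<in>K. ball x r) \<le> ennreal (?c * inverse (real (Suc m)))" .
    have "x \<in> (\<Union>(x, r)\<in>K. ball x r)" if x: "x \<in> ?Bad" for x
    proof -
      have "x \<in> U" using x U(2) by auto
      then obtain d where d: "0 < d" "ball x d \<subseteq> U" using U(1) openE by blast
      then obtain r where r: "0 < r" "r < min d 1" "ennreal \<delta> * emeasure M (ball x r) \<le> emeasure M (ball x r - A)"
        using x d(1) by (auto dest!: spec[of _ "min d 1"])
      then have "(x, r) \<in> K" using d subset_ball[of r d x] by (auto simp: K_def)
      then show ?thesis using r(1) by force
    qed
    moreover have "(\<Union>(x, r)\<in>K. ball x r) \<in> sets M" by (intro open_in_M) auto
    ultimately show ?thesis using le by blast
  qed
  then obtain W where W: "\<And>m. W m \<in> sets M" "\<And>m. ?Bad \<subseteq> W m"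
      "\<And>m. emeasure M (W m) \<le> ennreal (?c * inverse (real (Suc m)))"
    using choice[of "\<lambda>m W. W \<in> sets M \<and> ?Bad \<subseteq> W \<and> emeasure M W \<le> ennreal (?c * inverse (real (Suc m)))"]
    by blast
  have "emeasure M (\<Inter>m. W m) \<le> ennreal (?c * inverse (real (Suc m)))" for m
    using W by (intro order_trans[OF emeasure_mono W(3)]) auto
  moreover have "(\<lambda>m. ennreal (?c * inverse (real (Suc m)))) \<longlonglongrightarrow> ennreal (?c * 0)"
    by (intro tendsto_ennrealI tendsto_mult tendsto_const LIMSEQ_inverse_real_of_nat)
  ultimately have "emeasure M (\<Inter>m. W m) \<le> ennreal (?c * 0)"
    by (intro LIMSEQ_le_const) auto
  then have "(\<Inter>m. W m) \<in> null_sets M" using W(1) by auto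
  then show ?thesis using W(2) by (intro bexI[of _ "\<Inter>m. W m"]) blast+
qed

lemma density_points:
  assumes A: "A \<in> sets M" and \<delta>: "0 < \<delta>"
  shows "AE x in M. x \<in> A \<longrightarrow> (\<exists>r0>0. \<forall>r. 0 < r \<and> r < r0 \<longrightarrow>
      emeasure M (ball x r - A) < ennreal \<delta> * emeasure M (ball x r))"
proof -
  let ?P = "\<lambda>x. \<forall>r0>0. \<exists>r. 0 < r \<and> r < r0 \<and>
      ennreal \<delta> * emeasure M (ball x r) \<le> emeasure M (ball x r - A)"
  obtain W where W: "\<And>N::nat. W N \<in> null_sets M"
      "\<And>N. {x \<in> A \<inter> ball undefined (real N). ?P x} \<subseteq> W N"
    using bchoice[of UNIV "\<lambda>N W. W \<in> null_sets M \<and> {x \<in> A \<inter> ball undefined (real N). ?P x} \<subseteq> W"]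
      density_bad_set_null[OF A \<delta>, of undefined] by auto blast
  have "{x \<in> space M. \<not> (x \<in> A \<longrightarrow> (\<exists>r0>0. \<forall>r. 0 < r \<and> r < r0 \<longrightarrow>
      emeasure M (ball x r - A) < ennreal \<delta> * emeasure M (ball x r)))} \<subseteq> (\<Union>N. W N)"
  proof
    fix x assume "x \<in> {x \<in> space M. \<not> (x \<in> A \<longrightarrow> (\<exists>r0>0. \<forall>r. 0 < r \<and> r < r0 \<longrightarrow>
      emeasure M (ball x r - A) < ennreal \<delta> * emeasure M (ball x r)))}"
    then have x: "x \<in> A" "?P x"
      unfolding not_less[symmetric] by blast+
    obtain N where "dist undefined x < real N" using reals_Archimedean2 by blast
    then have "x \<in> W N" using W(2)[of N] x by auto
    then show "x \<in> (\<Union>N. W N)" by blast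
  qed
  then show ?thesis using W(1) by (intro AE_I'[of "\<Union>N. W N"]) auto
qed

text \<open>This replaces Lebesgue differentiation for functions that need not be integrable on any
  ball. Density points of the preimages of intervals with rational endpoints suffice: there are
  countably many of them, so one null set serves for all \<open>e\<close>.\<close>

lemma approximate_continuity:
  assumes u: "u \<in> borel_measurable M" and \<delta>: "0 < \<delta>"
  shows "AE x in M. \<forall>e>0. \<exists>r0>0. \<forall>r. 0 < r \<and> r < r0 \<longrightarrow>
      measure M {z \<in> ball x r. e \<le> \<bar>u z - u x :: real\<bar>} < \<delta> * measure M (ball x r)"
proof -
  let ?A = "\<lambda>q::rat \<times> rat. u -` {real_of_rat (fst q)<..<real_of_rat (snd q)}"
  have A: "?A q \<in> sets M" for q
    using measurable_sets[OF u, of "{real_of_rat (fst q)<..<real_of_rat (snd q)}"] by simp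
  have "AE x in M. \<forall>q. x \<in> ?A q \<longrightarrow> (\<exists>r0>0. \<forall>r. 0 < r \<and> r < r0 \<longrightarrow>
      emeasure M (ball x r - ?A q) < ennreal \<delta> * emeasure M (ball x r))"
    unfolding AE_all_countable using density_points[OF A \<delta>] by blast
  then show ?thesis
  proof (rule AE_mp, intro AE_I2 impI allI)
    fix x and e :: real assume e: "0 < e"
    assume all: "\<forall>q. x \<in> ?A q \<longrightarrow> (\<exists>r0>0. \<forall>r. 0 < r \<and> r < r0 \<longrightarrow>
      emeasure M (ball x r - ?A q) < ennreal \<delta> * emeasure M (ball x r))"
    obtain a b where ab: "u x - e < real_of_rat a" "real_of_rat a < u x" "u x < real_of_rat b" "real_of_rat b < u x + e"
      using of_rat_dense[of "u x - e" "u x"] of_rat_dense[of "u x" "u x + e"] e by auto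
    then have "x \<in> ?A (a, b)" by simp
    then obtain r0 where r0: "0 < r0" "\<And>r. 0 < r \<Longrightarrow> r < r0 \<Longrightarrow>
        emeasure M (ball x r - ?A (a, b)) < ennreal \<delta> * emeasure M (ball x r)"
      using all by blast
    have "measure M {z \<in> ball x r. e \<le> \<bar>u z - u x\<bar>} < \<delta> * measure M (ball x r)" if r: "0 < r" "r < r0" for r
    proof -
      have le: "emeasure M {z \<in> ball x r. e \<le> \<bar>u z - u x\<bar>} \<le> emeasure M (ball x r - ?A (a, b))"
        using ab A[of "(a, b)"] by (intro emeasure_mono) auto
      also have "\<dots> < ennreal (\<delta> * measure M (ball x r))"
        using r0(2)[OF r] \<delta> by (simp add: emeasure_ball ennreal_mult)
      finally have lt: "emeasure M {z \<in> ball x r. e \<le> \<bar>u z - u x\<bar>} < ennreal (\<delta> * measure M (ball x r))" .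
      then have "emeasure M {z \<in> ball x r. e \<le> \<bar>u z - u x\<bar>} = ennreal (measure M {z \<in> ball x r. e \<le> \<bar>u z - u x\<bar>})"
        by (intro emeasure_eq_ennreal_measure) auto
      then show ?thesis using lt by (simp add: ennreal_less_iff)
    qed
    then show "\<exists>r0>0. \<forall>r. 0 < r \<and> r < r0 \<longrightarrow>
      measure M {z \<in> ball x r. e \<le> \<bar>u z - u x\<bar>} < \<delta> * measure M (ball x r)"
      using r0(1) by blast
  qed
qed

end

section \<open>The maximal function\<close>

lemma ennreal_divide_le_iff:
  fixes a b c :: ennreal
  assumes "b \<noteq> 0" "b \<noteq> \<infinity>"
  shows "a / b \<le> c \<longleftrightarrow> a \<le> c * b"
proof
  assume "a / b \<le> c"
  then have "a / b * b \<le> c * b" by (rule mult_right_mono) simp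
  then show "a \<le> c * b" using assms by (simp add: ennreal_divide_times less_top)
next
  assume "a \<le> c * b"
  then show "a / b \<le> c"
    using assms by (intro divide_le_posI_ennreal) (auto simp: mult.commute zero_less_iff_neq_zero)
qed

section \<open>Shrunken balls, lower semicontinuity and measurability\<close>

lemma ball_minus_dist_subset: "ball y (t - dist x y) \<subseteq> ball x (t::real)"
proof
  fix z assume "z \<in> ball y (t - dist x y)"
  then show "z \<in> ball x t" using dist_triangle[of x z y] by auto
qed

lemma eventually_in_balls:
  fixes X :: "nat \<Rightarrow> 'a::metric_space"
  assumes X: "X \<longlonglongrightarrow> x" and z: "z \<in> ball x t"
  shows "\<forall>\<^sub>F k in sequentially. z \<in> ball (X k) (t - dist x (X k))"
proof -
  have "(\<lambda>k. dist x (X k)) \<longlonglongrightarrow> 0"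
    using tendsto_dist[OF tendsto_const X, of x] by simp
  moreover have "0 < (t - dist x z) / 2" using z by simp
  ultimately have "\<forall>\<^sub>F k in sequentially. dist x (X k) < (t - dist x z) / 2"
    by (rule order_tendstoD)
  then show ?thesis
  proof eventually_elim
    case (elim k)
    then show ?case using dist_triangle[of "X k" z x] by (simp add: dist_commute)
  qed
qed

lemma nn_integral_powr_Ioo:
  assumes "-1 < a" "0 \<le> c"
  shows "(\<integral>\<^sup>+l. ennreal (l powr a) * indicator {0<..<c} l \<partial>lborel) = ennreal (c powr (a + 1) / (a + 1))"
  using has_integral_powr_from_0[OF assms]
  by (intro nn_integral_has_integral_lebesgue') (auto simp: has_integral_Icc_iff_Ioo)

context doubling_metric_measure begin

text \<open>The balls about \<open>X k\<close> are shrunk by the displacement of their centres: they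
  lie in \<open>ball x t\<close> and eventually contain each of its points, so Fatou carries a bound
  at the points \<open>X k\<close> over to \<open>x\<close>. The integrand may vary with
  \<open>k\<close> because the sharp maximal functions subtract constants that depend on the
  ball.\<close>

lemma fatou_balls:
  fixes f :: "nat \<Rightarrow> 'a \<Rightarrow> ennreal"
  assumes X: "X \<longlonglongrightarrow> x" and f: "\<And>k. f k \<in> borel_measurable M"
    and lim: "\<And>z. (\<lambda>k. f k z) \<longlonglongrightarrow> g z"
    and bound: "\<And>k. 0 < t - dist x (X k) \<Longrightarrow> (\<integral>\<^sup>+z\<in>ball (X k) (t - dist x (X k)). f k z \<partial>M) \<le> b"
  shows "(\<integral>\<^sup>+z\<in>ball x t. g z \<partial>M) \<le> b"
proof -
  let ?B = "\<lambda>k. ball (X k) (t - dist x (X k))"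
  have bound': "(\<integral>\<^sup>+z\<in>?B k. f k z \<partial>M) \<le> b" for k
    using bound[of k] by (cases "0 < t - dist x (X k)") (auto simp: not_less ball_empty)
  have "(\<integral>\<^sup>+z\<in>ball x t. g z \<partial>M) \<le> (\<integral>\<^sup>+z. liminf (\<lambda>k. f k z * indicator (?B k) z) \<partial>M)"
  proof (rule nn_integral_mono)
    fix z
    show "g z * indicator (ball x t) z \<le> liminf (\<lambda>k. f k z * indicator (?B k) z)"
    proof (cases "z \<in> ball x t")
      case True
      then have "\<forall>\<^sub>F k in sequentially. f k z * indicator (?B k) z = f k z"
        using eventually_in_balls[OF X, of z t] by (auto elim: eventually_mono)
      then have "(\<lambda>k. f k z * indicator (?B k) z) \<longlonglongrightarrow> g z"
        using lim[of z] by (simp add: tendsto_cong)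
      then have "liminf (\<lambda>k. f k z * indicator (?B k) z) = g z"
        by (intro lim_imp_Liminf) auto
      then show ?thesis using True by simp
    qed simp
  qed
  also have "\<dots> \<le> liminf (\<lambda>k. \<integral>\<^sup>+z\<in>?B k. f k z \<partial>M)"
    using f by (intro nn_integral_liminf) auto
  also have "\<dots> \<le> limsup (\<lambda>k. \<integral>\<^sup>+z\<in>?B k. f k z \<partial>M)"
    by (intro Liminf_le_Limsup) auto
  also have "\<dots> \<le> b"
    by (intro Limsup_bounded always_eventually allI bound')
  finally show ?thesis .
qed

text \<open>Measurability of the averages for each radius would not pass to a supremum over
  uncountably many radii; lower semicontinuity, stated here through sequences, does.\<close>

lemma borel_measurable_closed_sublevel:
  fixes F :: "'a \<Rightarrow> ennreal"
  assumes "\<And>X x c. X \<longlonglongrightarrow> x \<Longrightarrow> 0 \<le> c \<Longrightarrow> (\<And>k. F (X k) \<le> ennreal c) \<Longrightarrow> F x \<le> ennreal c"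
  shows "F \<in> borel_measurable M"
proof (rule borel_measurableI_le)
  fix y :: ennreal
  show "{x \<in> space M. F x \<le> y} \<in> sets M"
  proof (cases y)
    case (real c)
    have "closed {x. F x \<le> y}"
      unfolding closed_sequential_limits using assms[of _ _ c] real by auto
    then show ?thesis using borel_in_M[of "{x. F x \<le> y}"] by simp
  next
    case top then show ?thesis using borel_in_M[of UNIV] by simp
  qed
qed

lemma sigma_finite_M: "sigma_finite_measure M"
proof
  have "x \<in> (\<Union>N. ball undefined (real N))" for x :: 'a
  proof -
    obtain N where "dist undefined x < real N" using reals_Archimedean2 by blast
    then show ?thesis by auto
  qed
  then have "(\<Union>N. ball undefined (real N)) = (UNIV :: 'a set)" by blast
  then show "\<exists>A. countable A \<and> A \<subseteq> sets M \<and> \<Union>A = space M \<and> (\<forall>a\<in>A. emeasure M a \<noteq> \<infinity>)"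
    using ball_not_top by (intro exI[of _ "range (\<lambda>N. ball undefined (real N))"]) auto
qed

text \<open>The Hardy-Littlewood maximal function in its centred form, matching the balls of the
  sharp maximal functions.\<close>

definition maximal :: "('a \<Rightarrow> ennreal) \<Rightarrow> 'a \<Rightarrow> ennreal" where
  "maximal f x = (SUP t\<in>{0<..}. nn_avg M (ball x t) f)"

lemma maximal_le_iff:
  "maximal f x \<le> c \<longleftrightarrow> (\<forall>t>0. (\<integral>\<^sup>+z\<in>ball x t. f z \<partial>M) \<le> c * emeasure M (ball x t))"
  unfolding maximal_def nn_avg_def SUP_le_iff
  using ball_nonzero ball_not_top by (auto simp: ennreal_divide_le_iff)

lemma less_maximalE:
  assumes "c < maximal f x"
  obtains t where "0 < t" "c * emeasure M (ball x t) < (\<integral>\<^sup>+z\<in>ball x t. f z \<partial>M)"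
  using assms maximal_le_iff[of f x c] by (auto simp: not_le[symmetric])

lemma maximal_measurable:
  assumes f: "f \<in> borel_measurable M"
  shows "maximal f \<in> borel_measurable M"
proof (rule borel_measurable_closed_sublevel)
  fix X :: "nat \<Rightarrow> 'a" and x and c :: real
  assume X: "X \<longlonglongrightarrow> x" and c: "\<And>k. maximal f (X k) \<le> ennreal c"
  have "(\<integral>\<^sup>+z\<in>ball x t. f z \<partial>M) \<le> ennreal c * emeasure M (ball x t)" for t
  proof (rule fatou_balls[OF X, of "\<lambda>_. f"])
    fix k assume r: "0 < t - dist x (X k)"
    have "(\<integral>\<^sup>+z\<in>ball (X k) (t - dist x (X k)). f z \<partial>M) \<le> ennreal c * emeasure M (ball (X k) (t - dist x (X k)))"
      using c[of k] r unfolding maximal_le_iff by blast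
    also have "\<dots> \<le> ennreal c * emeasure M (ball x t)"
      by (intro mult_left_mono emeasure_mono ball_minus_dist_subset) auto
    finally show "(\<integral>\<^sup>+z\<in>ball (X k) (t - dist x (X k)). f z \<partial>M) \<le> ennreal c * emeasure M (ball x t)" .
  qed (use f in auto)
  then show "maximal f x \<le> ennreal c" unfolding maximal_le_iff by blast
qed

lemma maximal_weak_type:
  assumes f: "f \<in> borel_measurable M" and c: "0 < c"
  shows "emeasure M {x. ennreal c < maximal f x} \<le> ennreal (C1 * 5 powr n / c) * (\<integral>\<^sup>+z. f z \<partial>M)"
proof -
  \<comment> \<open>The covering inequality requires bounded radii. The bound \<open>R\<close> is
    removed at the end by monotone exhaustion.\<close>
  define K where "K R = {(x, r). 0 < r \<and> r \<le> real R \<and> ennreal c * emeasure M (ball x r) < (\<integral>\<^sup>+z\<in>ball x r. f z \<partial>M)}" for R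
  let ?U = "\<lambda>R. \<Union>(x, r)\<in>K R. ball x r"
  have f': "(\<lambda>z. ennreal (1 / c) * f z) \<in> borel_measurable M" using f by measurable
  have eq: "(\<integral>\<^sup>+z\<in>V. ennreal (1 / c) * f z \<partial>M) = ennreal (1 / c) * (\<integral>\<^sup>+z\<in>V. f z \<partial>M)" if "V \<in> sets M" for V
    using f that by (simp add: mult.assoc nn_integral_cmult)
  have le: "emeasure M (?U R) \<le> ennreal (C1 * 5 powr n / c) * (\<integral>\<^sup>+z. f z \<partial>M)" for R
  proof -
    have "emeasure M (?U R) \<le> ennreal (C1 * 5 powr n) * (\<integral>\<^sup>+z. ennreal (1 / c) * f z \<partial>M)"
    proof (rule vitali_measure[OF f'])
      show "0 < r \<and> r \<le> real R" if "(x, r) \<in> K R" for x r using that by (auto simp: K_def)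
      show "emeasure M (ball x r) \<le> (\<integral>\<^sup>+z\<in>ball x r. ennreal (1 / c) * f z \<partial>M)" if "(x, r) \<in> K R" for x r
      proof -
        have "ennreal (1 / c) * (ennreal c * emeasure M (ball x r)) \<le> ennreal (1 / c) * (\<integral>\<^sup>+z\<in>ball x r. f z \<partial>M)"
          using that by (intro mult_left_mono) (auto simp: K_def intro: less_imp_le)
        moreover have "ennreal (1 / c) * (ennreal c * emeasure M (ball x r)) = emeasure M (ball x r)"
          using c by (simp add: mult.assoc[symmetric] ennreal_mult[symmetric])
        ultimately show ?thesis by (simp add: eq)
      qed
    qed
    also have "\<dots> = ennreal (C1 * 5 powr n / c) * (\<integral>\<^sup>+z. f z \<partial>M)"
      using c C1_gt_1 f by (simp add: nn_integral_cmult mult.assoc[symmetric] ennreal_mult[symmetric])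
    finally show ?thesis .
  qed
  have sets: "?U R \<in> sets M" for R by (intro open_in_M) auto
  have "x \<in> (\<Union>R. ?U R)" if x: "ennreal c < maximal f x" for x
  proof -
    obtain t where t: "0 < t" "ennreal c * emeasure M (ball x t) < (\<integral>\<^sup>+z\<in>ball x t. f z \<partial>M)"
      using less_maximalE[OF x] by blast
    obtain R :: nat where "t < real R" using reals_Archimedean2 by blast
    then have "(x, t) \<in> K R" using t by (auto simp: K_def)
    then show ?thesis using t(1) by (intro UN_I[of R] UN_I[of "(x, t)"]) auto
  qed
  then have "emeasure M {x. ennreal c < maximal f x} \<le> emeasure M (\<Union>R. ?U R)"
    using sets by (intro emeasure_mono) auto
  also have "\<dots> = (SUP R. emeasure M (?U R))"
  proof (rule SUP_emeasure_incseq[symmetric])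
    show "incseq ?U" by (rule incseq_SucI) (fastforce simp: K_def)
  qed (use sets in auto)
  also have "\<dots> \<le> ennreal (C1 * 5 powr n / c) * (\<integral>\<^sup>+z. f z \<partial>M)"
    by (rule SUP_least) (rule le)
  finally show ?thesis .
qed

text \<open>Values of \<open>f\<close> up to \<open>c / 2\<close> contribute at most
  \<open>c / 2\<close> to any average, so the part above must account for the other half. Only with
  this truncation does the integral over all levels converge at zero.\<close>

lemma maximal_weak_type_truncated:
  assumes f: "f \<in> borel_measurable M" and c: "0 < c"
  shows "emeasure M {x. ennreal c < maximal f x} \<le>
    ennreal (2 * C1 * 5 powr n / c) * (\<integral>\<^sup>+z. f z * indicator {z. ennreal (c / 2) < f z} z \<partial>M)"
proof -
  let ?g = "\<lambda>z. f z * indicator {z. ennreal (c / 2) < f z} z"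
  have g: "?g \<in> borel_measurable M" using f by measurable
  have "ennreal (c / 2) < maximal ?g x" if x: "ennreal c < maximal f x" for x
  proof (rule ccontr)
    assume "\<not> ennreal (c / 2) < maximal ?g x"
    then have le: "(\<integral>\<^sup>+z\<in>ball x t. ?g z \<partial>M) \<le> ennreal (c / 2) * emeasure M (ball x t)" if "0 < t" for t
      using maximal_le_iff[of ?g x "ennreal (c / 2)"] that by (auto simp: not_less)
    have "(\<integral>\<^sup>+z\<in>ball x t. f z \<partial>M) \<le> ennreal c * emeasure M (ball x t)" if t: "0 < t" for t
    proof -
      have "(\<integral>\<^sup>+z\<in>ball x t. f z \<partial>M) \<le> (\<integral>\<^sup>+z. ?g z * indicator (ball x t) z + ennreal (c / 2) * indicator (ball x t) z \<partial>M)"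
        by (intro nn_integral_mono) (auto simp: indicator_def not_less)
      also have "\<dots> = (\<integral>\<^sup>+z\<in>ball x t. ?g z \<partial>M) + ennreal (c / 2) * emeasure M (ball x t)"
        using g by (subst nn_integral_add) (auto simp: nn_integral_cmult_indicator)
      also have "\<dots> \<le> ennreal (c / 2) * emeasure M (ball x t) + ennreal (c / 2) * emeasure M (ball x t)"
        by (intro add_right_mono le t)
      also have "\<dots> = ennreal c * emeasure M (ball x t)"
        using c by (simp add: distrib_right[symmetric] ennreal_plus[symmetric] del: ennreal_plus)
      finally show ?thesis .
    qed
    then show False using x maximal_le_iff[of f x "ennreal c"] by (auto simp: not_less[symmetric])
  qed
  moreover have "{x \<in> space M. ennreal (c / 2) < maximal ?g x} \<in> sets M"
    using maximal_measurable[OF g] by measurable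
  then have "{x. ennreal (c / 2) < maximal ?g x} \<in> sets M" by simp
  ultimately have "emeasure M {x. ennreal c < maximal f x} \<le> emeasure M {x. ennreal (c / 2) < maximal ?g x}"
    by (intro emeasure_mono) auto
  also have "\<dots> \<le> ennreal (C1 * 5 powr n / (c / 2)) * (\<integral>\<^sup>+z. ?g z \<partial>M)"
    using maximal_weak_type[OF g, of "c / 2"] c by simp
  finally show ?thesis by (simp add: mult_ac)
qed

text \<open>Layer-cake formula: the weak type bound, with \<open>f\<close> truncated at half the level, is integrated
  against \<open>r l\<^sup>r\<^sup>-\<^sup>1\<close> over all levels \<open>l\<close>.\<close>

lemma maximal_strong_type:
  fixes f :: "'a \<Rightarrow> real"
  assumes f: "f \<in> borel_measurable M" "\<And>z. 0 \<le> f z" and r: "1 < r"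
  shows "(\<integral>\<^sup>+x. enn_powr (maximal (\<lambda>z. ennreal (f z)) x) r \<partial>M) \<le>
    ennreal (C1 * 5 powr n * 2 powr r * r / (r - 1)) * (\<integral>\<^sup>+x. ennreal (f x powr r) \<partial>M)"
proof -
  define F where "F = maximal (\<lambda>z. ennreal (f z))"
  interpret sigma_finite_measure M by (rule sigma_finite_M)
  interpret P: pair_sigma_finite M lborel ..
  have [measurable]: "f \<in> borel_measurable M" by fact
  have [measurable]: "F \<in> borel_measurable M"
    unfolding F_def by (rule maximal_measurable) measurable
  have "{x \<in> space M. ennreal l < F x} \<in> sets M" for l by measurable
  then have measurable_sets_greater: "{x. ennreal l < F x} \<in> sets M" for l by simp
  let ?k = "2 * C1 * 5 powr n"
  have k: "0 < ?k" using C1_gt_1 by simp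
  have layer: "enn_powr (F x) r \<le> (\<integral>\<^sup>+l. ennreal (r * l powr (r - 1)) * indicator {l. 0 < l \<and> ennreal l < F x} l \<partial>lborel)" (is "_ \<le> ?I x") for x
  proof -
    have low: "ennreal (c powr r) \<le> ?I x" if c: "0 \<le> c" "ennreal c \<le> F x" for c
    proof -
      have "ennreal (c powr r) = ennreal r * (\<integral>\<^sup>+l. ennreal (l powr (r - 1)) * indicator {0<..<c} l \<partial>lborel)"
        using r c(1) by (subst nn_integral_powr_Ioo) (auto simp: ennreal_mult[symmetric])
      also have "\<dots> = (\<integral>\<^sup>+l. ennreal r * (ennreal (l powr (r - 1)) * indicator {0<..<c} l) \<partial>lborel)"
        by (rule nn_integral_cmult[symmetric]) measurable
      also have "\<dots> \<le> ?I x"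
        using r c by (intro nn_integral_mono)
          (auto simp: indicator_def ennreal_mult ennreal_less_iff
            intro: order_less_le_trans[of _ "ennreal c"])
      finally show ?thesis .
    qed
    show ?thesis
    proof (cases "F x")
      case (real c)
      then show ?thesis using low[of c] by (simp add: enn_powr_def)
    next
      case top
      \<comment> \<open>Where \<open>F x\<close> is infinite, every c is admissible in
        \<open>low\<close>; c = \<open>real N powr (1 / r)\<close> makes the integral at least N,
        for every N.\<close>
      have big: "ennreal (real N) \<le> ?I x" for N :: nat
        using low[of "real N powr (1 / r)"] top r by (simp add: powr_powr)
      have "?I x = top"
      proof (cases "?I x")
        case (real v)
        obtain N :: nat where "v < real N" using reals_Archimedean2 by blast
        then show ?thesis using big[of N] real by simp
      qed
      then show ?thesis by simp
    qed
  qed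
  have "(\<integral>\<^sup>+x. enn_powr (F x) r \<partial>M) \<le> (\<integral>\<^sup>+x. ?I x \<partial>M)"
    by (intro nn_integral_mono layer)
  also have "\<dots> = (\<integral>\<^sup>+l. (\<integral>\<^sup>+x. ennreal (r * l powr (r - 1)) * indicator {l. 0 < l \<and> ennreal l < F x} l \<partial>M) \<partial>lborel)"
    by (rule P.Fubini'[symmetric]) measurable
  also have "\<dots> \<le> (\<integral>\<^sup>+l. (\<integral>\<^sup>+x. ennreal (r * ?k * l powr (r - 2)) * (ennreal (f x) * indicator {l. 0 < l \<and> l < 2 * f x} l) \<partial>M) \<partial>lborel)"
  proof (rule nn_integral_mono)
    fix l :: real
    show "(\<integral>\<^sup>+x. ennreal (r * l powr (r - 1)) * indicator {l. 0 < l \<and> ennreal l < F x} l \<partial>M) \<le>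
       (\<integral>\<^sup>+x. ennreal (r * ?k * l powr (r - 2)) * (ennreal (f x) * indicator {l. 0 < l \<and> l < 2 * f x} l) \<partial>M)"
    proof (cases "0 < l")
      case True
      have "(\<integral>\<^sup>+x. ennreal (r * l powr (r - 1)) * indicator {l. 0 < l \<and> ennreal l < F x} l \<partial>M) =
          (\<integral>\<^sup>+x. ennreal (r * l powr (r - 1)) * indicator {x. ennreal l < F x} x \<partial>M)"
        using True by (intro nn_integral_cong) (auto simp: indicator_def)
      also have "\<dots> = ennreal (r * l powr (r - 1)) * emeasure M {x \<in> space M. ennreal l < F x}"
        using measurable_sets_greater by (subst nn_integral_cmult_indicator) auto
      also have "\<dots> \<le> ennreal (r * l powr (r - 1)) *
          (ennreal (?k / l) * (\<integral>\<^sup>+z. ennreal (f z) * indicator {z. ennreal (l / 2) < ennreal (f z)} z \<partial>M))"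
        unfolding F_def using maximal_weak_type_truncated[of "\<lambda>z. ennreal (f z)" l] True
        by (intro mult_left_mono) auto
      also have "\<dots> = ennreal (r * l powr (r - 1) * (?k / l)) * (\<integral>\<^sup>+z. ennreal (f z) * indicator {z. ennreal (l / 2) < ennreal (f z)} z \<partial>M)"
      proof -
        have "ennreal (r * l powr (r - 1) * (?k / l)) = ennreal (r * l powr (r - 1)) * ennreal (?k / l)"
          using r k True by (intro ennreal_mult) auto
        then show ?thesis by (simp only: mult.assoc)
      qed
      also have "r * l powr (r - 1) * (?k / l) = r * ?k * l powr (r - 2)"
        using True powr_add[of l "r - 2" 1] by simp
      also have "(\<integral>\<^sup>+z. ennreal (f z) * indicator {z. ennreal (l / 2) < ennreal (f z)} z \<partial>M) =
          (\<integral>\<^sup>+x. ennreal (f x) * indicator {l. 0 < l \<and> l < 2 * f x} l \<partial>M)"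
        using True by (intro nn_integral_cong) (auto simp: indicator_def ennreal_less_iff)
      also have "ennreal (r * ?k * l powr (r - 2)) * \<dots> =
         (\<integral>\<^sup>+x. ennreal (r * ?k * l powr (r - 2)) * (ennreal (f x) * indicator {l. 0 < l \<and> l < 2 * f x} l) \<partial>M)"
        by (rule nn_integral_cmult[symmetric]) measurable
      finally show ?thesis .
    qed simp
  qed
  also have "\<dots> = (\<integral>\<^sup>+x. (\<integral>\<^sup>+l. ennreal (r * ?k * l powr (r - 2)) * (ennreal (f x) * indicator {l. 0 < l \<and> l < 2 * f x} l) \<partial>lborel) \<partial>M)"
    by (rule P.Fubini') measurable
  also have "\<dots> = (\<integral>\<^sup>+x. ennreal (C1 * 5 powr n * 2 powr r * r / (r - 1)) * ennreal (f x powr r) \<partial>M)"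
  proof (rule nn_integral_cong)
    fix x
    have "(\<integral>\<^sup>+l. ennreal (r * ?k * l powr (r - 2)) * (ennreal (f x) * indicator {l. 0 < l \<and> l < 2 * f x} l) \<partial>lborel) =
        (\<integral>\<^sup>+l. ennreal (r * ?k * f x) * (ennreal (l powr (r - 2)) * indicator {0<..<2 * f x} l) \<partial>lborel)"
    proof (rule nn_integral_cong)
      fix l :: real
      have "ennreal (r * ?k * l powr (r - 2)) * ennreal (f x) = ennreal (r * ?k * l powr (r - 2) * f x)"
        using r k f(2)[of x] by (intro ennreal_mult[symmetric]) auto
      also have "r * ?k * l powr (r - 2) * f x = r * ?k * f x * l powr (r - 2)"
        by (simp only: mult_ac)
      also have "ennreal \<dots> = ennreal (r * ?k * f x) * ennreal (l powr (r - 2))"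
        using r k f(2)[of x] by (intro ennreal_mult) auto
      finally have "ennreal (r * ?k * l powr (r - 2)) * ennreal (f x) = ennreal (r * ?k * f x) * ennreal (l powr (r - 2))" .
      moreover have "indicator {l. 0 < l \<and> l < 2 * f x} l = (indicator {0<..<2 * f x} l :: ennreal)"
        by (simp add: indicator_def)
      ultimately show "ennreal (r * ?k * l powr (r - 2)) * (ennreal (f x) * indicator {l. 0 < l \<and> l < 2 * f x} l) =
          ennreal (r * ?k * f x) * (ennreal (l powr (r - 2)) * indicator {0<..<2 * f x} l)"
        by (simp only: mult.assoc[symmetric])
    qed
    \<comment> \<open>The exponent r - 2 is above -1 exactly because r > 1. Collecting 2 * 2^(r - 1)
      = 2^r gives the constant of the statement.\<close>
    also have "\<dots> = ennreal (r * ?k * f x) * ennreal ((2 * f x) powr (r - 1) / (r - 1))"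
      using nn_integral_powr_Ioo[of "r - 2" "2 * f x"] r f(2)[of x] by (subst nn_integral_cmult) auto
    also have "\<dots> = ennreal (r * ?k * f x * ((2 * f x) powr (r - 1) / (r - 1)))"
      using r k f(2)[of x] by (intro ennreal_mult[symmetric]) auto
    also have "r * ?k * f x * ((2 * f x) powr (r - 1) / (r - 1)) =
        C1 * 5 powr n * 2 powr r * r / (r - 1) * (f x powr r)"
      using r f(2)[of x] by (cases "f x = 0") (auto simp: powr_mult powr_diff field_simps)
    also have "ennreal \<dots> = ennreal (C1 * 5 powr n * 2 powr r * r / (r - 1)) * ennreal (f x powr r)"
      using r C1_gt_1 by (intro ennreal_mult) auto
    finally show "(\<integral>\<^sup>+l. ennreal (r * ?k * l powr (r - 2)) * (ennreal (f x) * indicator {l. 0 < l \<and> l < 2 * f x} l) \<partial>lborel) =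
      ennreal (C1 * 5 powr n * 2 powr r * r / (r - 1)) * ennreal (f x powr r)" .
  qed
  also have "\<dots> = ennreal (C1 * 5 powr n * 2 powr r * r / (r - 1)) * (\<integral>\<^sup>+x. ennreal (f x powr r) \<partial>M)"
    by (rule nn_integral_cmult) measurable
  finally show ?thesis unfolding F_def .
qed

section \<open>The Sobolev-Poincare inequality for Hajlasz gradients\<close>


text \<open>Chebyshev: within \<open>ball x R\<close> the set where \<open>g\<close> exceeds A 2^j
  has at most the fraction 2^(-q j) of the measure. A ball with more than this share cannot be
  contained in it, even after adding the null set \<open>E\<close>.\<close>

lemma level_set_meets_ball:
  assumes g: "g \<in> borel_measurable M" "\<And>z. 0 \<le> g z" and E: "E \<in> null_sets M"
    and A: "0 < A" and q: "0 < q"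
    and int: "(\<integral>\<^sup>+z\<in>ball x R. ennreal (g z powr q) \<partial>M) \<le> ennreal (A powr q) * emeasure M (ball x R)"
    and sub: "ball y \<rho> \<subseteq> ball x R"
    and big: "measure M (ball x R) * 2 powr (- (q * real j)) < measure M (ball y \<rho>)"
  shows "\<exists>z\<in>ball y \<rho>. z \<notin> E \<and> g z \<le> A * 2 ^ j"
proof (rule ccontr)
  assume neg: "\<not> ?thesis"
  let ?S = "{z \<in> space M. A * 2 ^ j < g z} \<inter> ball x R"
  have S: "?S \<in> sets M" using g(1) by measurable
  have "ball y \<rho> \<subseteq> ?S \<union> E"
    using neg sub by (auto simp: not_le)
  then have "emeasure M (ball y \<rho>) \<le> emeasure M (?S \<union> E)"
    using S E by (intro emeasure_mono) auto
  also have "\<dots> = emeasure M ?S" using S E by (rule emeasure_Un_null_set)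
  finally have le: "emeasure M (ball y \<rho>) \<le> emeasure M ?S" .
  define d where "d = (A * 2 ^ j) powr q"
  have d: "0 < d" using A by (simp add: d_def)
  have "ennreal d * emeasure M ?S = (\<integral>\<^sup>+z. ennreal d * indicator ?S z \<partial>M)"
    using S by (simp add: nn_integral_cmult_indicator)
  also have "\<dots> \<le> (\<integral>\<^sup>+z\<in>ball x R. ennreal (g z powr q) \<partial>M)"
    using A q by (intro nn_integral_mono) (auto simp: indicator_def d_def intro!: powr_mono2)
  also note int
  finally have "ennreal d * emeasure M (ball y \<rho>) \<le> ennreal (A powr q) * emeasure M (ball x R)"
    using mult_left_mono[OF le, of "ennreal d"] by (auto intro: order_trans)
  then have "d * measure M (ball y \<rho>) \<le> A powr q * measure M (ball x R)"
    using d by (simp add: emeasure_ball ennreal_mult[symmetric])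
  also have "A powr q = d * 2 powr (- (q * real j))"
    using A unfolding d_def by (simp add: powr_mult powr_minus powr_powr mult.commute flip: powr_realpow)
  finally have "measure M (ball y \<rho>) \<le> 2 powr (- (q * real j)) * measure M (ball x R)"
    using d by (simp add: mult.assoc)
  then show False using big by (simp add: mult.commute)
qed

text \<open>The doubling condition compares concentric balls, so the centre is moved first:
  \<open>ball x R\<close> lies in \<open>ball y (2 * R)\<close>, and the dilation factor there is
  \<open>2 * R / \<rho>\<close>.\<close>

lemma measure_ball_le:
  assumes "0 < \<rho>" "\<rho> < 2 * R" "y \<in> ball x R"
  shows "measure M (ball x R) \<le> C1 * (2 * R / \<rho>) powr n * measure M (ball y \<rho>)"
proof -
  have "ball x R \<subseteq> ball y (2 * R)"
  proof
    fix z assume "z \<in> ball x R"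
    then show "z \<in> ball y (2 * R)" using assms(3) dist_triangle[of y z x] by (simp add: dist_commute)
  qed
  then have "emeasure M (ball x R) \<le> emeasure M (ball y (2 * R))" by (intro emeasure_mono) auto
  then have "measure M (ball x R) \<le> measure M (ball y (2 * R / \<rho> * \<rho>))"
    using assms by (simp add: emeasure_ball)
  also have "\<dots> \<le> C1 * (2 * R / \<rho>) powr n * measure M (ball y \<rho>)"
    using assms by (intro doubling_real) auto
  finally show ?thesis .
qed

text \<open>At each level \<open>2\<^sup>j\<close> the radius \<open>\<rho>\<close> is so small that \<open>\<rho>\<^sup>n\<close> is comparable with the measure of the set
  where \<open>g\<close> exceeds that level. Passing to the next lower level then costs \<open>\<rho>\<^sup>s 2\<^sup>j\<close>, which is geometric
  in \<open>j\<close> with ratio \<open>\<beta>\<close>.\<close>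

lemma level_chain:
  fixes s q r A \<Lambda> \<theta> \<beta> :: real
  assumes s: "0 < s" and q: "0 < q" and \<theta>: "\<theta> = 2 powr (- q / n)"
    and \<Lambda>: "\<Lambda> = 4 * (2 * C1) powr (1 / n)"
    and \<beta>: "\<beta> = 2 * \<theta> powr s" "1 < \<beta>" and k0: "\<Lambda> * \<theta> ^ k0 \<le> 1 - \<theta>"
    and g: "g \<in> borel_measurable M" "\<And>z. 0 \<le> g z" and E: "E \<in> null_sets M"
    and ug: "\<And>x y. x \<notin> E \<Longrightarrow> y \<notin> E \<Longrightarrow> \<bar>u x - u y\<bar> \<le> dist x y powr s * (g x + g y)"
    and r: "0 < r" and A: "0 < A"
    and int: "(\<integral>\<^sup>+z\<in>ball x (2 * r). ennreal (g z powr q) \<partial>M) \<le> ennreal (A powr q) * emeasure M (ball x (2 * r))"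
  shows "y \<notin> E \<Longrightarrow> dist x y < r + r * \<theta> ^ i \<Longrightarrow> g y \<le> A * 2 ^ (k0 + i) \<Longrightarrow>
    \<exists>z. dist x z < 2 * r \<and> z \<notin> E \<and> g z \<le> A * 2 ^ k0 \<and>
      \<bar>u y - u z\<bar> \<le> 3 * A * r powr s * \<Lambda> powr s * (\<beta> ^ (k0 + i) / (\<beta> - 1))"
proof (induction i arbitrary: y)
  case 0
  have "0 \<le> 3 * A * r powr s * \<Lambda> powr s * (\<beta> ^ (k0 + 0) / (\<beta> - 1))" using A \<beta>(2) by simp
  then show ?case using 0 by (intro exI[of _ y]) auto
next
  case (Suc i)
  have \<theta>01: "0 < \<theta>" "\<theta> < 1" using q n_pos by (auto simp: \<theta> powr_less_one)
  have \<Lambda>0: "0 < \<Lambda>" using C1_gt_1 by (simp add: \<Lambda>)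
  \<comment> \<open>In \<Lambda> the factor 4 cancels the ratio of the diameter 4r of
    \<open>ball x (2 * r)\<close> to r, and \<open>2 * C1\<close> absorbs the doubling constant with
    a factor 2 to spare. Since \<theta>^n = 2^(-q), \<open>ball y \<rho>\<close> thus has at least
    twice the share that Chebyshev allows to the set above level k0 + i.\<close>
  define \<rho> where "\<rho> = r * \<Lambda> * \<theta> ^ (k0 + i)"
  have \<rho>0: "0 < \<rho>" using r \<Lambda>0 \<theta>01 by (simp add: \<rho>_def)
  have "\<rho> = r * \<theta> ^ i * (\<Lambda> * \<theta> ^ k0)" by (simp add: \<rho>_def power_add)
  also have "\<dots> \<le> r * \<theta> ^ i * (1 - \<theta>)"
    using k0 r \<theta>01 by (intro mult_left_mono) auto
  \<comment> \<open>The radii r + r \<theta>^i form a budget: a point at stage i + 1 may move by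
    \<rho> and still satisfies the bound for stage i. The whole chain therefore stays inside
    \<open>ball x (2 * r)\<close>. The choice of \<open>k0\<close> provides this room.\<close>
  finally have \<rho>le: "\<rho> \<le> r * \<theta> ^ i - r * \<theta> ^ Suc i" by (simp add: algebra_simps)
  have \<theta>i: "\<theta> ^ i \<le> 1" using \<theta>01 by (simp add: power_le_one)
  then have r\<theta>: "r * \<theta> ^ i \<le> r" using r by simp
  have y2: "y \<in> ball x (2 * r)"
  proof -
    have "r * \<theta> ^ Suc i \<le> r" using \<theta>01 r by (simp add: power_le_one mult_le_one)
    then show ?thesis using Suc.prems(2) by simp
  qed
  have sub: "dist x z < r + r * \<theta> ^ i" if "z \<in> ball y \<rho>" for z
    using dist_triangle[of x z y] that Suc.prems(2) \<rho>le by auto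
  have "\<rho> < 2 * (2 * r)" using \<rho>le r\<theta> r \<theta>01 zero_less_power[OF \<theta>01(1), of "Suc i"]
    by (smt (verit) mult_pos_pos)
  then have "measure M (ball x (2 * r)) \<le> C1 * (2 * (2 * r) / \<rho>) powr n * measure M (ball y \<rho>)"
    using \<rho>0 y2 by (intro measure_ball_le) auto
  also have "C1 * (2 * (2 * r) / \<rho>) powr n = 2 powr (q * real (k0 + i)) / 2"
  proof -
    have "\<theta> ^ (k0 + i) = 2 powr (- q / n * real (k0 + i))"
      using \<theta> by (simp add: powr_powr flip: powr_realpow)
    then have "(\<theta> ^ (k0 + i)) powr n = 2 powr (- (q * real (k0 + i)))"
      using n_pos by (simp add: powr_powr)
    moreover have "((2 * C1) powr (1 / n)) powr n = 2 * C1" using n_pos C1_gt_1 by (simp add: powr_powr)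
    moreover have "2 * (2 * r) / \<rho> = 1 / ((2 * C1) powr (1 / n) * \<theta> ^ (k0 + i))"
      using r by (simp add: \<rho>_def \<Lambda>)
    ultimately have "(2 * (2 * r) / \<rho>) powr n = 1 / (2 * C1 * 2 powr (- (q * real (k0 + i))))"
      using \<theta>01 by (simp add: powr_divide powr_mult)
    also have "2 * C1 * 2 powr (- (q * real (k0 + i))) = 2 * C1 / 2 powr (q * real (k0 + i))"
      by (simp only: powr_minus_divide) simp
    finally show ?thesis using C1_gt_1 by simp
  qed
  finally have m: "measure M (ball x (2 * r)) \<le> 2 powr (q * real (k0 + i)) / 2 * measure M (ball y \<rho>)" .
  have "measure M (ball x (2 * r)) * 2 powr (- (q * real (k0 + i))) \<le>
      2 powr (q * real (k0 + i)) / 2 * measure M (ball y \<rho>) * 2 powr (- (q * real (k0 + i)))"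
    using m by (rule mult_right_mono) simp
  also have "\<dots> = measure M (ball y \<rho>) / 2" by (simp add: powr_minus)
  also have "\<dots> < measure M (ball y \<rho>)" using ball_measure_pos[OF \<rho>0] by simp
  finally have big: "measure M (ball x (2 * r)) * 2 powr (- (q * real (k0 + i))) < measure M (ball y \<rho>)" .
  have "ball y \<rho> \<subseteq> ball x (2 * r)" using sub r\<theta> by force
  then obtain y1 where y1: "y1 \<in> ball y \<rho>" "y1 \<notin> E" "g y1 \<le> A * 2 ^ (k0 + i)"
    using level_set_meets_ball[OF g E A q int _ big] by blast
  obtain z where z: "dist x z < 2 * r" "z \<notin> E" "g z \<le> A * 2 ^ k0"
    "\<bar>u y1 - u z\<bar> \<le> 3 * A * r powr s * \<Lambda> powr s * (\<beta> ^ (k0 + i) / (\<beta> - 1))"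
    using Suc.IH[OF y1(2) sub[OF y1(1)] y1(3)] by blast
  have "\<bar>u y - u y1\<bar> \<le> dist y y1 powr s * (g y + g y1)" using ug Suc.prems(1) y1(2) by blast
  also have "\<dots> \<le> \<rho> powr s * (A * 2 ^ (k0 + Suc i) + A * 2 ^ (k0 + i))"
    using y1 Suc.prems(3) s A g(2) by (intro mult_mono add_mono powr_mono2) auto
  also have "\<rho> powr s = r powr s * \<Lambda> powr s * (\<theta> powr s) ^ (k0 + i)"
    using r \<Lambda>0 \<theta>01 by (simp add: \<rho>_def powr_mult powr_powr mult.commute flip: powr_realpow)
  \<comment> \<open>The 3 is 2 + 1, from the two neighbouring levels of \<open>y\<close> and
    \<open>y1\<close>.\<close>
  also have "r powr s * \<Lambda> powr s * (\<theta> powr s) ^ (k0 + i) * (A * 2 ^ (k0 + Suc i) + A * 2 ^ (k0 + i)) =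
      3 * A * r powr s * \<Lambda> powr s * \<beta> ^ (k0 + i)"
    by (simp add: \<beta>(1) power_mult_distrib algebra_simps)
  finally have "\<bar>u y - u z\<bar> \<le> 3 * A * r powr s * \<Lambda> powr s * (\<beta> ^ (k0 + i) + \<beta> ^ (k0 + i) / (\<beta> - 1))"
    using z(4) by (simp add: distrib_left)
  \<comment> \<open>The expression \<beta>^m / (\<beta> - 1) is chosen to absorb one more term
    \<beta>^m while keeping its form with m + 1.\<close>
  also have "\<beta> ^ (k0 + i) + \<beta> ^ (k0 + i) / (\<beta> - 1) = \<beta> ^ (k0 + Suc i) / (\<beta> - 1)"
    using \<beta>(2) by (simp add: field_simps)
  finally show ?case using z by blast
qed

text \<open>The chain from a point of level k0 + i costs a multiple of \<beta>^(k0 + i). Since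
  \<beta> = 2^(1 - q s / n), this is a power of the level, hence of g / A. All chains end at level
  at most k0 inside \<open>ball x (2 * r)\<close>, where one further application of the gradient
  inequality compares them with a single base point \<open>w\<close>, and c is
  \<open>u w\<close>.\<close>

lemma hajlasz_oscillation:
  assumes s: "0 < s" and q: "0 < q" "q * s < n"
  shows "\<exists>K. 0 < K \<and> (\<forall>u g x r A. g \<in> hajlasz_gradients M s u \<and> 0 < r \<and> 0 < A \<and>
     (\<integral>\<^sup>+z\<in>ball x (2 * r). ennreal (g z powr q) \<partial>M) \<le> ennreal (A powr q) * emeasure M (ball x (2 * r)) \<longrightarrow>
     (\<exists>c. AE y in M. y \<in> ball x r \<longrightarrow>
        \<bar>u y - c\<bar> \<le> K * r powr s * A * max 1 (g y / A) powr (1 - q * s / n)))"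
proof -
  define \<theta> where "\<theta> = 2 powr (- q / n)"
  define \<Lambda> where "\<Lambda> = 4 * (2 * C1) powr (1 / n)"
  define \<beta> where "\<beta> = 2 * \<theta> powr s"
  let ?\<alpha> = "1 - q * s / n"
  have \<beta>\<alpha>: "\<beta> = 2 powr ?\<alpha>"
  proof -
    have "\<theta> powr s = 2 powr (- (q * s / n))" by (simp add: \<theta>_def powr_powr)
    then show ?thesis using powr_add[of 2 1 "- (q * s / n)"] by (simp add: \<beta>_def)
  qed
  have \<alpha>: "0 < ?\<alpha>" using q(2) n_pos by (simp add: field_simps)
  then have \<beta>1: "1 < \<beta>" by (simp add: \<beta>\<alpha>)
  have \<theta>01: "0 < \<theta>" "\<theta> < 1" using q n_pos by (auto simp: \<theta>_def powr_less_one)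
  have \<Lambda>0: "0 < \<Lambda>" using C1_gt_1 by (simp add: \<Lambda>_def)
  obtain k1 where "\<theta> ^ k1 < (1 - \<theta>) / \<Lambda>"
    using real_arch_pow_inv[of "(1 - \<theta>) / \<Lambda>" \<theta>] \<theta>01 \<Lambda>0 by auto
  then have k1: "\<Lambda> * \<theta> ^ k1 \<le> 1 - \<theta>" using \<Lambda>0 by (simp add: field_simps)
  \<comment> \<open>Positivity of \<open>k0\<close> makes 2^(-q k0) strictly less than 1, so that
    \<open>ball x (2 * r)\<close> itself contains a base point at level k0.\<close>
  define k0 where "k0 = Suc k1"
  have "\<theta> ^ k0 \<le> \<theta> ^ k1" using \<theta>01 by (simp add: k0_def mult_left_le_one_le)
  then have k0: "\<Lambda> * \<theta> ^ k0 \<le> 1 - \<theta>"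
    using k1 \<Lambda>0 by (smt (verit) mult_left_mono)
  define K where "K = (3 * \<Lambda> powr s / (\<beta> - 1) + 2 * 4 powr s * 2 ^ k0) * \<beta> ^ Suc k0"
  have "0 < K" using \<beta>1 \<Lambda>0 by (auto simp: K_def intro!: mult_pos_pos add_pos_pos)
  moreover have "\<exists>c. AE y in M. y \<in> ball x r \<longrightarrow>
        \<bar>u y - c\<bar> \<le> K * r powr s * A * max 1 (g y / A) powr ?\<alpha>"
    if gg: "g \<in> hajlasz_gradients M s u" and r: "0 < r" and A: "0 < A"
      and int: "(\<integral>\<^sup>+z\<in>ball x (2 * r). ennreal (g z powr q) \<partial>M) \<le> ennreal (A powr q) * emeasure M (ball x (2 * r))"
    for u g x r A
  proof -
    obtain E where E: "E \<in> null_sets M"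
      and ug: "\<And>x y. x \<notin> E \<Longrightarrow> y \<notin> E \<Longrightarrow> \<bar>u x - u y\<bar> \<le> dist x y powr s * (g x + g y)"
      using gg by (auto simp: hajlasz_gradients_def)
    have g: "g \<in> borel_measurable M" "\<And>z. 0 \<le> g z" using gg by (auto simp: hajlasz_gradients_def)
    have "measure M (ball x (2 * r)) * 2 powr (- (q * real k0)) < measure M (ball x (2 * r))"
      using ball_measure_pos[of "2 * r" x] r q(1) by (simp add: powr_less_one k0_def)
    then obtain w where w: "w \<in> ball x (2 * r)" "w \<notin> E" "g w \<le> A * 2 ^ k0"
      using level_set_meets_ball[OF g E A q(1) int order_refl] by blast
    have "\<bar>u y - u w\<bar> \<le> K * r powr s * A * max 1 (g y / A) powr ?\<alpha>" if y: "y \<notin> E" "y \<in> ball x r" for y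
    proof -
      \<comment> \<open>Minimality is what bounds the chain from above by \<open>g y\<close>: if i =
        j + 1 then A 2^j is below \<open>g y\<close>, so \<beta>^j is at most the desired power. The
        surplus \<beta>^(k0 + 1) goes into \<open>K\<close>.\<close>
      define i where "i = (LEAST i. g y \<le> A * 2 ^ (k0 + i))"
      obtain N where "g y / A < 2 ^ N" using real_arch_pow[of 2 "g y / A"] by auto
      then have "g y \<le> A * 2 ^ N" using A by (simp add: field_simps)
      also have "\<dots> \<le> A * 2 ^ (k0 + N)" using A by simp
      finally have i: "g y \<le> A * 2 ^ (k0 + i)" unfolding i_def by (rule LeastI)
      have \<beta>i: "\<beta> ^ (k0 + i) \<le> \<beta> ^ Suc k0 * max 1 (g y / A) powr ?\<alpha>"
      proof (cases i)
        case 0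
        have "1 \<le> max 1 (g y / A) powr ?\<alpha>" using \<alpha> by (intro ge_one_powr_ge_zero) auto
        then have "\<beta> ^ Suc k0 * 1 \<le> \<beta> ^ Suc k0 * max 1 (g y / A) powr ?\<alpha>"
          using \<beta>1 by (intro mult_left_mono) auto
        moreover have "\<beta> ^ k0 \<le> \<beta> ^ Suc k0" using \<beta>1 by (intro power_increasing) auto
        ultimately show ?thesis using 0 by simp
      next
        case (Suc j)
        then have "\<not> g y \<le> A * 2 ^ (k0 + j)"
          using not_less_Least[of j "\<lambda>i. g y \<le> A * 2 ^ (k0 + i)"] by (auto simp: i_def)
        moreover have "A * 2 ^ j \<le> A * 2 ^ (k0 + j)" using A by simp
        ultimately have "A * 2 ^ j \<le> g y" by linarith
        then have "2 ^ j \<le> max 1 (g y / A)" using A by (simp add: field_simps le_max_iff_disj)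
        then have "(2 ^ j) powr ?\<alpha> \<le> max 1 (g y / A) powr ?\<alpha>"
          using \<alpha> by (intro powr_mono2) auto
        moreover have "(2 ^ j) powr ?\<alpha> = \<beta> ^ j"
          unfolding \<beta>\<alpha> by (simp add: powr_powr mult.commute flip: powr_realpow)
        ultimately have "\<beta> ^ Suc k0 * \<beta> ^ j \<le> \<beta> ^ Suc k0 * max 1 (g y / A) powr ?\<alpha>"
          using \<beta>1 by (intro mult_left_mono) auto
        then show ?thesis using Suc by (simp add: power_add mult_ac)
      qed
      have "dist x y < r + r * \<theta> ^ i" using y(2) mult_pos_pos[OF r zero_less_power[OF \<theta>01(1), of i]] by simp
      then obtain z where z: "dist x z < 2 * r" "z \<notin> E" "g z \<le> A * 2 ^ k0"
        "\<bar>u y - u z\<bar> \<le> 3 * A * r powr s * \<Lambda> powr s * (\<beta> ^ (k0 + i) / (\<beta> - 1))"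
        using level_chain[OF s q(1) \<theta>_def \<Lambda>_def \<beta>_def \<beta>1 k0 g E ug r A int y(1) _ i] by blast
      \<comment> \<open>Both points lie in \<open>ball x (2 * r)\<close>, hence the distance 4r.
        This last comparison is of fixed size and is multiplied by \<beta>^(k0 + i), which is at
        least 1, to join the chain term.\<close>
      have "\<bar>u z - u w\<bar> \<le> dist z w powr s * (g z + g w)" using ug z(2) w(2) by blast
      also have "\<dots> \<le> (4 * r) powr s * (A * 2 ^ k0 + A * 2 ^ k0)"
        using z w g(2) A s dist_triangle[of z w x]
        by (intro mult_mono add_mono powr_mono2) (auto simp: dist_commute)
      also have "\<dots> = A * r powr s * (2 * 4 powr s * 2 ^ k0) * 1" using r by (simp add: powr_mult)
      also have "\<dots> \<le> A * r powr s * (2 * 4 powr s * 2 ^ k0) * \<beta> ^ (k0 + i)"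
        using A \<beta>1 by (intro mult_left_mono one_le_power) auto
      finally have "\<bar>u y - u w\<bar> \<le> A * r powr s * (3 * \<Lambda> powr s / (\<beta> - 1) + 2 * 4 powr s * 2 ^ k0) * \<beta> ^ (k0 + i)"
        using z(4) by (simp add: algebra_simps)
      also have "\<dots> \<le> A * r powr s * (3 * \<Lambda> powr s / (\<beta> - 1) + 2 * 4 powr s * 2 ^ k0) * (\<beta> ^ Suc k0 * max 1 (g y / A) powr ?\<alpha>)"
        using A \<beta>1 by (intro mult_left_mono \<beta>i) auto
      also have "\<dots> = K * r powr s * A * max 1 (g y / A) powr ?\<alpha>" by (simp add: K_def mult_ac)
      finally show ?thesis .
    qed
    then have "AE y in M. y \<in> ball x r \<longrightarrow> \<bar>u y - u w\<bar> \<le> K * r powr s * A * max 1 (g y / A) powr ?\<alpha>"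
      using AE_not_in[OF E] by (auto elim: AE_mp)
    then show ?thesis by blast
  qed
  ultimately show ?thesis by blast
qed

text \<open>The \<sigma>-th power of the pointwise bound is a constant times max(1, g / A)^q, whose
  integral is controlled by the hypothesis. The parameter \<open>A\<close> is any positive upper
  bound rather than the exact mean, which avoids division by zero when \<open>g\<close> vanishes on
  the ball.\<close>

lemma hajlasz_poincare:
  assumes s: "0 < s" and \<sigma>: "0 < \<sigma>"
  defines "q \<equiv> n * \<sigma> / (n + \<sigma> * s)"
  shows "\<exists>K>0. \<forall>u g x r A. u \<in> borel_measurable M \<and> g \<in> hajlasz_gradients M s u \<and> 0 < r \<and> 0 < A \<and>
     (\<integral>\<^sup>+z\<in>ball x (2 * r). ennreal (g z powr q) \<partial>M) \<le> ennreal (A powr q) * emeasure M (ball x (2 * r)) \<longrightarrow>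
     (\<exists>c. (\<integral>\<^sup>+z\<in>ball x r. ennreal (\<bar>u z - c\<bar> powr \<sigma>) \<partial>M) \<le>
        ennreal ((K * r powr s * A) powr \<sigma>) * emeasure M (ball x r))"
proof -
  have pos: "0 < n + \<sigma> * s" using n_pos s \<sigma> by (simp add: add_pos_pos)
  have "q * s / n = \<sigma> * s / (n + \<sigma> * s)" using n_pos by (simp add: q_def)
  then have "1 - q * s / n = n / (n + \<sigma> * s)" using pos by (simp add: field_simps)
  \<comment> \<open>This identity is the origin of q: it turns the exponent of the oscillation bound
    into the exponent at which \<open>g\<close> is integrated.\<close>
  then have q3: "(1 - q * s / n) * \<sigma> = q" by (simp add: q_def)
  have "n * (\<sigma> * s) < n * (n + \<sigma> * s)" using n_pos by simp
  then have "q * s < n" using pos by (simp add: q_def field_simps)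
  moreover have "0 < q" using n_pos \<sigma> pos by (simp add: q_def)
  ultimately have q: "0 < q" "q * s < n" "(1 - q * s / n) * \<sigma> = q" using q3 by auto
  obtain K where K: "0 < K" and all: "\<forall>u g x r A. g \<in> hajlasz_gradients M s u \<and> 0 < r \<and> 0 < A \<and>
     (\<integral>\<^sup>+z\<in>ball x (2 * r). ennreal (g z powr q) \<partial>M) \<le> ennreal (A powr q) * emeasure M (ball x (2 * r)) \<longrightarrow>
     (\<exists>c. AE y in M. y \<in> ball x r \<longrightarrow>
        \<bar>u y - c\<bar> \<le> K * r powr s * A * max 1 (g y / A) powr (1 - q * s / n))"
    using hajlasz_oscillation[OF s q(1,2)] by (elim exE conjE)
  \<comment> \<open>The 1 comes from the constant part of max(1, g / A)^q, and
    \<open>C1 * 2 powr n\<close> from the measure of the doubled ball over which \<open>g\<close> is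
    integrated.\<close>
  define D where "D = 1 + C1 * 2 powr n"
  have D: "1 < D" using C1_gt_1 by (simp add: D_def)
  define K' where "K' = K * D powr (1 / \<sigma>)"
  have K': "0 < K'" using K D by (simp add: K'_def)
  moreover have "\<exists>c. (\<integral>\<^sup>+z\<in>ball x r. ennreal (\<bar>u z - c\<bar> powr \<sigma>) \<partial>M) \<le>
        ennreal ((K' * r powr s * A) powr \<sigma>) * emeasure M (ball x r)"
    if u: "u \<in> borel_measurable M" and gg: "g \<in> hajlasz_gradients M s u" and r: "0 < r" and A: "0 < A"
      and int: "(\<integral>\<^sup>+z\<in>ball x (2 * r). ennreal (g z powr q) \<partial>M) \<le> ennreal (A powr q) * emeasure M (ball x (2 * r))"
    for u g x r A
  proof -
    have g: "g \<in> borel_measurable M" "\<And>z. 0 \<le> g z" using gg by (auto simp: hajlasz_gradients_def)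
    obtain c where c: "AE y in M. y \<in> ball x r \<longrightarrow>
        \<bar>u y - c\<bar> \<le> K * r powr s * A * max 1 (g y / A) powr (1 - q * s / n)"
      using all[rule_format, OF conjI[OF gg conjI[OF r conjI[OF A int]]]] by (elim exE)
    let ?T = "(K * r powr s * A) powr \<sigma>"
    have "(\<integral>\<^sup>+z\<in>ball x r. ennreal (\<bar>u z - c\<bar> powr \<sigma>) \<partial>M) \<le>
      (\<integral>\<^sup>+z. ennreal ?T * (indicator (ball x r) z + ennreal (1 / A powr q) * (ennreal (g z powr q) * indicator (ball x (2 * r)) z)) \<partial>M)"
    proof (rule nn_integral_mono_AE, rule AE_mp[OF c], intro AE_I2 impI)
      fix z assume z: "z \<in> ball x r \<longrightarrow> \<bar>u z - c\<bar> \<le> K * r powr s * A * max 1 (g z / A) powr (1 - q * s / n)"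
      show "ennreal (\<bar>u z - c\<bar> powr \<sigma>) * indicator (ball x r) z \<le>
        ennreal ?T * (indicator (ball x r) z + ennreal (1 / A powr q) * (ennreal (g z powr q) * indicator (ball x (2 * r)) z))"
      proof (cases "z \<in> ball x r")
        case True
        then have z2: "z \<in> ball x (2 * r)" using r by auto
        have "\<bar>u z - c\<bar> powr \<sigma> \<le> (K * r powr s * A * max 1 (g z / A) powr (1 - q * s / n)) powr \<sigma>"
          using z True \<sigma> by (intro powr_mono2) auto
        also have "\<dots> = ?T * max 1 (g z / A) powr q"
          using K A by (simp add: powr_mult powr_powr q(3))
        also have "\<dots> \<le> ?T * (1 + 1 / A powr q * g z powr q)"
        proof (rule mult_left_mono)
          show "max 1 (g z / A) powr q \<le> 1 + 1 / A powr q * g z powr q"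
            using A g(2)[of z] by (auto simp: max_def powr_divide)
        qed simp
        finally show ?thesis
          using True z2 by (simp add: ennreal_mult[symmetric] ennreal_plus[symmetric] ennreal_1[symmetric]
             del: ennreal_plus ennreal_1)
      qed simp
    qed
    also have "\<dots> = ennreal ?T * (emeasure M (ball x r) + ennreal (1 / A powr q) * (\<integral>\<^sup>+z\<in>ball x (2 * r). ennreal (g z powr q) \<partial>M))"
      using g(1) by (simp add: nn_integral_cmult nn_integral_add)
    also have "\<dots> \<le> ennreal ?T * (emeasure M (ball x r) + ennreal (1 / A powr q) * (ennreal (A powr q) * emeasure M (ball x (2 * r))))"
      by (intro mult_left_mono add_left_mono int) auto
    also have "ennreal (1 / A powr q) * (ennreal (A powr q) * emeasure M (ball x (2 * r))) = emeasure M (ball x (2 * r))"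
      using A by (simp add: mult.assoc[symmetric] ennreal_mult[symmetric])
    also have "ennreal ?T * (emeasure M (ball x r) + emeasure M (ball x (2 * r))) \<le>
        ennreal ?T * (ennreal D * emeasure M (ball x r))"
    proof (rule mult_left_mono)
      show "emeasure M (ball x r) + emeasure M (ball x (2 * r)) \<le> ennreal D * emeasure M (ball x r)"
        using doubling[OF r, of 2 x] C1_gt_1
        by (simp add: D_def ennreal_plus distrib_right add_left_mono)
    qed simp
    also have "\<dots> = ennreal ((K' * r powr s * A) powr \<sigma>) * emeasure M (ball x r)"
    proof -
      have "(K' * r powr s * A) powr \<sigma> = ?T * D"
        using K D A \<sigma> by (simp add: K'_def powr_mult powr_powr mult_ac)
      then show ?thesis using D by (simp add: ennreal_mult mult.assoc)
    qed
    finally show ?thesis by blast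
  qed
  ultimately show ?thesis by (intro exI[of _ K']) blast
qed

end

section \<open>The sharp maximal functions\<close>

lemma enn_powr_ennreal: "0 \<le> c \<Longrightarrow> enn_powr (ennreal c) a = ennreal (c powr a)"
  by (simp add: enn_powr_def)

lemma enn_powr_top: "enn_powr top a = top"
  by (simp add: enn_powr_def)

lemma enn_powr_inverse_le_iff:
  assumes "0 < \<sigma>" "0 \<le> b"
  shows "enn_powr x (1 / \<sigma>) \<le> ennreal b \<longleftrightarrow> x \<le> ennreal (b powr \<sigma>)"
proof (cases x)
  case (real v)
  have "v powr (1 / \<sigma>) \<le> b \<longleftrightarrow> v \<le> b powr \<sigma>"
  proof
    assume "v powr (1 / \<sigma>) \<le> b"
    then have "(v powr (1 / \<sigma>)) powr \<sigma> \<le> b powr \<sigma>" using assms by (intro powr_mono2) auto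
    then show "v \<le> b powr \<sigma>" using assms real by (simp add: powr_powr)
  next
    assume "v \<le> b powr \<sigma>"
    then have "v powr (1 / \<sigma>) \<le> (b powr \<sigma>) powr (1 / \<sigma>)" using assms real by (intro powr_mono2) auto
    then show "v powr (1 / \<sigma>) \<le> b" using assms by (simp add: powr_powr)
  qed
  then show ?thesis using real assms by (simp add: enn_powr_ennreal)
qed (simp add: enn_powr_top top_unique)

lemma ennreal_powr_mult_le_iff:
  assumes "0 < t" "0 \<le> a"
  shows "ennreal (t powr - s) * x \<le> ennreal a \<longleftrightarrow> x \<le> ennreal (a * t powr s)"
proof (cases x)
  case (real v)
  then show ?thesis using assms
    by (simp add: ennreal_mult[symmetric] powr_minus field_simps)
next
  case top
  then show ?thesis using assms by (simp add: ennreal_mult_top top_unique)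
qed

lemma INF_le_ennreal_iff:
  fixes H :: "'b \<Rightarrow> ennreal"
  assumes "0 \<le> b"
  shows "(INF c. H c) \<le> ennreal b \<longleftrightarrow> (\<forall>b'>b. \<exists>c. H c \<le> ennreal b')"
proof
  assume le: "(INF c. H c) \<le> ennreal b"
  show "\<forall>b'>b. \<exists>c. H c \<le> ennreal b'"
  proof (intro allI impI)
    fix b' assume "b < b'"
    then have "(INF c. H c) < ennreal b'"
      using le assms by (auto simp: ennreal_less_iff intro: le_less_trans)
    then show "\<exists>c. H c \<le> ennreal b'" by (auto simp: INF_less_iff intro: less_imp_le)
  qed
next
  assume all: "\<forall>b'>b. \<exists>c. H c \<le> ennreal b'"
  show "(INF c. H c) \<le> ennreal b"
  proof (rule ccontr)
    assume "\<not> ?thesis"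
    then obtain y where y: "ennreal b < y" "y < (INF c. H c)" by (metis dense not_le)
    then obtain v where v: "y = ennreal v" "0 \<le> v" by (cases y) (auto simp: top_unique)
    then have "b < v" using y assms by (simp add: ennreal_less_iff)
    then obtain c where "H c \<le> ennreal v" using all by blast
    then have "(INF c. H c) \<le> y" using v INF_lower[of c UNIV H] by auto
    then show False using y by simp
  qed
qed

text \<open>Compactness of the extended real line; an infinite limit of either sign means that the
  absolute values tend to infinity.\<close>

lemma convergent_or_unbounded_subseq:
  fixes c :: "nat \<Rightarrow> real"
  shows "\<exists>\<phi>. strict_mono \<phi> \<and> ((\<exists>l. (\<lambda>k. c (\<phi> k)) \<longlonglongrightarrow> l) \<or> (\<forall>B. \<forall>\<^sub>F k in sequentially. B < \<bar>c (\<phi> k)\<bar>))"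
proof -
  obtain l \<phi> where \<phi>: "strict_mono \<phi>" "((\<lambda>k. ereal (c k)) \<circ> \<phi>) \<longlonglongrightarrow> l"
    using compact_complete_linorder[of "\<lambda>k. ereal (c k)"] by blast
  then have lim: "(\<lambda>k. ereal (c (\<phi> k))) \<longlonglongrightarrow> l" by (simp add: o_def)
  show ?thesis
  proof (cases l)
    case (real r)
    then show ?thesis using \<phi>(1) lim by auto
  next
    case PInf
    then have "\<forall>\<^sub>F k in sequentially. ereal B < ereal (c (\<phi> k))" for B
      using lim by (intro order_tendstoD(1)) auto
    then have "\<forall>\<^sub>F k in sequentially. B < \<bar>c (\<phi> k)\<bar>" for B
      by (rule eventually_mono[of "\<lambda>k. ereal B < ereal (c (\<phi> k))"]) auto
    then show ?thesis using \<phi>(1) by blast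
  next
    case MInf
    then have "\<forall>\<^sub>F k in sequentially. ereal (c (\<phi> k)) < ereal (- B)" for B
      using lim by (intro order_tendstoD(2)) auto
    then have "\<forall>\<^sub>F k in sequentially. B < \<bar>c (\<phi> k)\<bar>" for B
      by (rule eventually_mono[of "\<lambda>k. ereal (c (\<phi> k)) < ereal (- B)"]) auto
    then show ?thesis using \<phi>(1) by blast
  qed
qed

context doubling_metric_measure begin

text \<open>This trades extended powers and the infimum for integral inequalities with an explicit
  constant. The slack \<open>a' > a\<close> stands for the fact that the infimum over constants is
  only approached.\<close>

lemma sharp_sigma_le_iff:
  assumes \<sigma>: "0 < \<sigma>" and a: "0 \<le> a"
  shows "sharp_sigma M s \<sigma> u x \<le> ennreal a \<longleftrightarrow> (\<forall>t>0. \<forall>a'>a. \<exists>c.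
    (\<integral>\<^sup>+z\<in>ball x t. ennreal (\<bar>u z - c\<bar> powr \<sigma>) \<partial>M) \<le> ennreal ((a' * t powr s) powr \<sigma>) * emeasure M (ball x t))"
proof -
  let ?I = "\<lambda>t c. \<integral>\<^sup>+z\<in>ball x t. ennreal (\<bar>u z - c\<bar> powr \<sigma>) \<partial>M"
  let ?H = "\<lambda>t c. enn_powr (nn_avg M (ball x t) (\<lambda>z. ennreal (\<bar>u z - c\<bar> powr \<sigma>))) (1 / \<sigma>)"
  have H: "?H t c \<le> ennreal b \<longleftrightarrow> ?I t c \<le> ennreal (b powr \<sigma>) * emeasure M (ball x t)" if "0 < t" "0 \<le> b" for t c b
    using that ball_nonzero[of t x] ball_not_top[of x t]
    by (simp add: enn_powr_inverse_le_iff[OF \<sigma>] nn_avg_def ennreal_divide_le_iff)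
  have "ennreal (t powr - s) * (INF c. ?H t c) \<le> ennreal a \<longleftrightarrow>
     (\<forall>a'>a. \<exists>c. ?I t c \<le> ennreal ((a' * t powr s) powr \<sigma>) * emeasure M (ball x t))" if t: "0 < t" for t
  proof -
    have "ennreal (t powr - s) * (INF c. ?H t c) \<le> ennreal a \<longleftrightarrow> (\<forall>b'>a * t powr s. \<exists>c. ?H t c \<le> ennreal b')"
      using t a by (simp add: ennreal_powr_mult_le_iff INF_le_ennreal_iff)
    also have "\<dots> \<longleftrightarrow> (\<forall>a'>a. \<exists>c. ?H t c \<le> ennreal (a' * t powr s))"
    proof safe
      fix a' assume "\<forall>b'>a * t powr s. \<exists>c. ?H t c \<le> ennreal b'" "a < a'"
      then show "\<exists>c. ?H t c \<le> ennreal (a' * t powr s)" using t by simp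
    next
      fix b' assume all: "\<forall>a'>a. \<exists>c. ?H t c \<le> ennreal (a' * t powr s)" and b': "a * t powr s < b'"
      have "a < b' / t powr s" using b' t by (simp add: field_simps)
      then have "\<exists>c. ?H t c \<le> ennreal (b' / t powr s * t powr s)" using all by blast
      then show "\<exists>c. ?H t c \<le> ennreal b'" using t by simp
    qed
    also have "\<dots> \<longleftrightarrow> (\<forall>a'>a. \<exists>c. ?I t c \<le> ennreal ((a' * t powr s) powr \<sigma>) * emeasure M (ball x t))"
      using H t a by simp
    finally show ?thesis .
  qed
  then show ?thesis unfolding sharp_sigma_def SUP_le_iff by auto
qed

lemma sharp_sigma_less_ennrealE:
  assumes \<sigma>: "0 < \<sigma>" and lt: "sharp_sigma M s \<sigma> u x < ennreal a" and t: "0 < t"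
  obtains c where "(\<integral>\<^sup>+z\<in>ball x t. ennreal (\<bar>u z - c\<bar> powr \<sigma>) \<partial>M) \<le> ennreal ((a * t powr s) powr \<sigma>) * emeasure M (ball x t)"
proof -
  obtain v where v: "sharp_sigma M s \<sigma> u x = ennreal v" "0 \<le> v"
    using lt by (cases "sharp_sigma M s \<sigma> u x") (auto simp: top_unique)
  then have "v < a" using lt by (simp add: ennreal_less_iff)
  then show thesis
    using sharp_sigma_le_iff[OF \<sigma> v(2), of s u x] v(1) t that by auto
qed

text \<open>Near-minimizing constants cannot escape to infinity, since by Fatou the limit integral
  would then be infinite.\<close>

lemma sharp_sigma_measurable:
  assumes s: "0 < s" and \<sigma>: "0 < \<sigma>" and u: "u \<in> borel_measurable M"
  shows "sharp_sigma M s \<sigma> u \<in> borel_measurable M"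
proof (rule borel_measurable_closed_sublevel)
  fix X :: "nat \<Rightarrow> 'a" and x and a :: real
  assume X: "X \<longlonglongrightarrow> x" and a: "0 \<le> a" and le: "\<And>k. sharp_sigma M s \<sigma> u (X k) \<le> ennreal a"
  show "sharp_sigma M s \<sigma> u x \<le> ennreal a"
    unfolding sharp_sigma_le_iff[OF \<sigma> a]
  proof (intro allI impI)
    fix t a' :: real assume t: "0 < t" and a': "a < a'"
    let ?b = "ennreal ((a' * t powr s) powr \<sigma>) * emeasure M (ball x t)"
    let ?r = "\<lambda>k. t - dist x (X k)"
    \<comment> \<open>For small k the shrunken radius may fail to be positive; the implication lets
      constants be chosen for every k.\<close>
    have "\<exists>c. 0 < ?r k \<longrightarrow> (\<integral>\<^sup>+z\<in>ball (X k) (?r k). ennreal (\<bar>u z - c\<bar> powr \<sigma>) \<partial>M) \<le> ?b" for k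
    proof (cases "0 < ?r k")
      case True
      then obtain c where "(\<integral>\<^sup>+z\<in>ball (X k) (?r k). ennreal (\<bar>u z - c\<bar> powr \<sigma>) \<partial>M) \<le>
          ennreal ((a' * ?r k powr s) powr \<sigma>) * emeasure M (ball (X k) (?r k))"
        using le[of k] a' unfolding sharp_sigma_le_iff[OF \<sigma> a] by blast
      also have "\<dots> \<le> ?b"
        using True a a' s \<sigma>
        by (intro mult_mono emeasure_mono ball_minus_dist_subset ennreal_leI powr_mono2 mult_left_mono) auto
      finally show ?thesis by blast
    qed auto
    then obtain c where c: "\<And>k. 0 < ?r k \<Longrightarrow>
        (\<integral>\<^sup>+z\<in>ball (X k) (?r k). ennreal (\<bar>u z - c k\<bar> powr \<sigma>) \<partial>M) \<le> ?b"
      using choice[of "\<lambda>k c. 0 < ?r k \<longrightarrow> (\<integral>\<^sup>+z\<in>ball (X k) (?r k). ennreal (\<bar>u z - c\<bar> powr \<sigma>) \<partial>M) \<le> ?b"] by blast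
    obtain \<phi> where \<phi>: "strict_mono \<phi>"
      and alt: "(\<exists>l. (\<lambda>k. c (\<phi> k)) \<longlonglongrightarrow> l) \<or> (\<forall>B. \<forall>\<^sub>F k in sequentially. B < \<bar>c (\<phi> k)\<bar>)"
      using convergent_or_unbounded_subseq[of c] by blast
    have X\<phi>: "(\<lambda>k. X (\<phi> k)) \<longlonglongrightarrow> x" using LIMSEQ_subseq_LIMSEQ[OF X \<phi>] by (simp add: o_def)
    have meas: "(\<lambda>z. ennreal (\<bar>u z - c (\<phi> k)\<bar> powr \<sigma>)) \<in> borel_measurable M" for k
      using u by measurable
    show "\<exists>c. (\<integral>\<^sup>+z\<in>ball x t. ennreal (\<bar>u z - c\<bar> powr \<sigma>) \<partial>M) \<le> ?b"
      using alt
    proof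
      assume "\<exists>l. (\<lambda>k. c (\<phi> k)) \<longlonglongrightarrow> l"
      then obtain l where l: "(\<lambda>k. c (\<phi> k)) \<longlonglongrightarrow> l" ..
      have "(\<integral>\<^sup>+z\<in>ball x t. ennreal (\<bar>u z - l\<bar> powr \<sigma>) \<partial>M) \<le> ?b"
      proof (rule fatou_balls[OF X\<phi> meas])
        show "(\<lambda>k. ennreal (\<bar>u z - c (\<phi> k)\<bar> powr \<sigma>)) \<longlonglongrightarrow> ennreal (\<bar>u z - l\<bar> powr \<sigma>)" for z
          using \<sigma> by (intro tendsto_ennrealI tendsto_powr' tendsto_rabs tendsto_diff tendsto_const l) auto
      qed (rule c)
      then show ?thesis by blast
    next
      assume inf: "\<forall>B. \<forall>\<^sub>F k in sequentially. B < \<bar>c (\<phi> k)\<bar>"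
      have "(\<integral>\<^sup>+z\<in>ball x t. top \<partial>M) \<le> ?b"
      proof (rule fatou_balls[OF X\<phi> meas])
        show "(\<lambda>k. ennreal (\<bar>u z - c (\<phi> k)\<bar> powr \<sigma>)) \<longlonglongrightarrow> top" for z
          unfolding tendsto_top_iff_ennreal
        proof (intro allI impI)
          fix b :: real assume b: "0 \<le> b"
          have "\<forall>\<^sub>F k in sequentially. \<bar>u z\<bar> + (b + 1) powr (1 / \<sigma>) < \<bar>c (\<phi> k)\<bar>" using inf by blast
          then show "\<forall>\<^sub>F k in sequentially. ennreal b < ennreal (\<bar>u z - c (\<phi> k)\<bar> powr \<sigma>)"
          proof eventually_elim
            case (elim k)
            then have "(b + 1) powr (1 / \<sigma>) \<le> \<bar>u z - c (\<phi> k)\<bar>" by linarith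
            then have "((b + 1) powr (1 / \<sigma>)) powr \<sigma> \<le> \<bar>u z - c (\<phi> k)\<bar> powr \<sigma>"
              using \<sigma> by (intro powr_mono2) auto
            then have "b < \<bar>u z - c (\<phi> k)\<bar> powr \<sigma>" using \<sigma> b by (simp add: powr_powr)
            then show ?case using b by (simp add: ennreal_less_iff)
          qed
        qed
      qed (rule c)
      also have "?b < top" using ball_not_top[of x t] by (simp add: ennreal_mult_less_top less_top)
      finally have "top * emeasure M (ball x t) < top" by (simp add: nn_integral_cmult_indicator)
      then show ?thesis using ball_nonzero[OF t, of x] by (simp add: ennreal_top_mult)
    qed
  qed
qed

section \<open>From the sharp maximal function to pointwise differences\<close>

lemma deviation_set:
  assumes "u \<in> borel_measurable M"
  shows "{z \<in> ball x t. b \<le> \<bar>u z - c :: real\<bar>} \<in> sets M" "emeasure M {z \<in> ball x t. b \<le> \<bar>u z - c\<bar>} \<noteq> \<infinity>"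
proof -
  have "{z \<in> space M. b \<le> \<bar>u z - c\<bar>} \<inter> ball x t \<in> sets M" using assms by measurable
  then show "{z \<in> ball x t. b \<le> \<bar>u z - c\<bar>} \<in> sets M" by (simp add: Int_def conj_commute)
  have "emeasure M {z \<in> ball x t. b \<le> \<bar>u z - c\<bar>} \<le> emeasure M (ball x t)" by (intro emeasure_mono) auto
  then show "emeasure M {z \<in> ball x t. b \<le> \<bar>u z - c\<bar>} \<noteq> \<infinity>"
    using ball_not_top[of x t] by (auto simp: top_unique)
qed

lemma measure_deviation_le:
  assumes \<sigma>: "0 < \<sigma>" and T: "0 < T" and L: "0 < L" and u: "u \<in> borel_measurable M"
    and int: "(\<integral>\<^sup>+z\<in>ball x t. ennreal (\<bar>u z - c\<bar> powr \<sigma>) \<partial>M) \<le> ennreal (T powr \<sigma>) * emeasure M (ball x t)"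
  shows "measure M {z \<in> ball x t. L * T \<le> \<bar>u z - c\<bar>} \<le> L powr - \<sigma> * measure M (ball x t)"
proof -
  let ?S = "{z \<in> ball x t. L * T \<le> \<bar>u z - c\<bar>}"
  have S: "?S \<in> sets M" and fin: "emeasure M ?S \<noteq> \<infinity>" using deviation_set[OF u] by blast+
  have "ennreal ((L * T) powr \<sigma>) * emeasure M ?S = (\<integral>\<^sup>+z. ennreal ((L * T) powr \<sigma>) * indicator ?S z \<partial>M)"
    using S by (simp add: nn_integral_cmult_indicator)
  also have "\<dots> \<le> (\<integral>\<^sup>+z\<in>ball x t. ennreal (\<bar>u z - c\<bar> powr \<sigma>) \<partial>M)"
    using L T \<sigma> by (intro nn_integral_mono) (auto simp: indicator_def intro!: powr_mono2)
  also note int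
  finally have "(L * T) powr \<sigma> * measure M ?S \<le> T powr \<sigma> * measure M (ball x t)"
    using fin by (simp add: emeasure_ball emeasure_eq_ennreal_measure ennreal_mult[symmetric])
  then have "T powr \<sigma> * (L powr \<sigma> * measure M ?S) \<le> T powr \<sigma> * measure M (ball x t)"
    using L T by (simp add: powr_mult mult_ac)
  then have "L powr \<sigma> * measure M ?S \<le> measure M (ball x t)" using T by simp
  then show ?thesis using L by (simp add: powr_minus field_simps)
qed

lemma common_good_point:
  assumes S: "S \<in> sets M" "S' \<in> sets M" and b: "measure M S \<le> b" "measure M S' \<le> b'"
    and lt: "b + b' < measure M (ball y t)"
    and fin: "emeasure M S \<noteq> \<infinity>" "emeasure M S' \<noteq> \<infinity>"
  shows "\<exists>z\<in>ball y t. z \<notin> S \<and> z \<notin> S'"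
proof (rule ccontr)
  assume "\<not> ?thesis"
  then have "ball y t \<subseteq> S \<union> S'" by blast
  then have "emeasure M (ball y t) \<le> emeasure M (S \<union> S')" using S by (intro emeasure_mono) auto
  also have "\<dots> \<le> emeasure M S + emeasure M S'" using S by (rule emeasure_subadditive)
  finally have "measure M (ball y t) \<le> measure M S + measure M S'"
    using fin by (simp add: emeasure_ball emeasure_eq_ennreal_measure ennreal_plus[symmetric] del: ennreal_plus)
  then show False using b lt by simp
qed

text \<open>The bad sets of the two constants occupy at most the fractions L^(-\<sigma>) D and
  L^(-\<sigma>) of the smaller ball. Their sum is below 1, so some point sees both constants.
  Comparing at a point works for every \<sigma>, including \<sigma> < 1.\<close>

lemma minimizers_close:
  assumes \<sigma>: "0 < \<sigma>" and L: "0 < L" "L powr - \<sigma> * (D + 1) < 1" and u: "u \<in> borel_measurable M"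
    and T: "0 < T" "0 < T'" and t: "0 < t'" 
    and D: "measure M (ball x t) \<le> D * measure M (ball y t')"
    and sub: "ball y t' \<subseteq> ball x t"
    and int: "(\<integral>\<^sup>+z\<in>ball x t. ennreal (\<bar>u z - c\<bar> powr \<sigma>) \<partial>M) \<le> ennreal (T powr \<sigma>) * emeasure M (ball x t)"
    and int': "(\<integral>\<^sup>+z\<in>ball y t'. ennreal (\<bar>u z - c'\<bar> powr \<sigma>) \<partial>M) \<le> ennreal (T' powr \<sigma>) * emeasure M (ball y t')"
  shows "\<bar>c - c'\<bar> \<le> L * (T + T')"
proof -
  let ?m = "measure M (ball y t')"
  have "\<exists>z\<in>ball y t'. z \<notin> {z \<in> ball x t. L * T \<le> \<bar>u z - c\<bar>} \<and> z \<notin> {z \<in> ball y t'. L * T' \<le> \<bar>u z - c'\<bar>}"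
  proof (rule common_good_point[OF deviation_set(1)[OF u] deviation_set(1)[OF u] _ _ _ deviation_set(2)[OF u] deviation_set(2)[OF u]])
    have "measure M {z \<in> ball x t. L * T \<le> \<bar>u z - c\<bar>} \<le> L powr - \<sigma> * measure M (ball x t)"
      by (rule measure_deviation_le[OF \<sigma> T(1) L(1) u int])
    also have "\<dots> \<le> L powr - \<sigma> * (D * ?m)" using D by (intro mult_left_mono) auto
    finally show "measure M {z \<in> ball x t. L * T \<le> \<bar>u z - c\<bar>} \<le> L powr - \<sigma> * (D * ?m)" .
    show "measure M {z \<in> ball y t'. L * T' \<le> \<bar>u z - c'\<bar>} \<le> L powr - \<sigma> * ?m"
      by (rule measure_deviation_le[OF \<sigma> T(2) L(1) u int'])
    show "L powr - \<sigma> * (D * ?m) + L powr - \<sigma> * ?m < ?m"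
      using mult_strict_right_mono[OF L(2) ball_measure_pos[OF t, of y]] by (simp add: algebra_simps)
  qed
  then obtain z where "z \<in> ball y t'" "\<bar>u z - c\<bar> < L * T" "\<bar>u z - c'\<bar> < L * T'"
    using sub by (auto simp: not_le)
  then show ?thesis by (simp add: distrib_left)
qed

text \<open>Constants on the balls of radius t / 2^k differ by a multiple of \<omega>^k with
  \<omega> = 2^(-s) < 1, and the geometric series gives 2 / (1 - \<omega>). The additional 1 is the
  deviation on the last ball, where approximate continuity links the constant to
  \<open>u x\<close>.\<close>

lemma minimizer_near_value:
  assumes \<sigma>: "0 < \<sigma>" and s: "0 < s" and L: "0 < L" "L powr - \<sigma> * (C1 * 2 powr n + 1) < 1" "L powr - \<sigma> \<le> 1 / 2"
    and u: "u \<in> borel_measurable M" and A: "0 < A" and t: "0 < t"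
    and fin: "sharp_sigma M s \<sigma> u x < ennreal A"
    and cont: "\<forall>e>0. \<exists>r0>0. \<forall>r. 0 < r \<and> r < r0 \<longrightarrow>
      measure M {z \<in> ball x r. e \<le> \<bar>u z - u x\<bar>} < 1 / 2 * measure M (ball x r)"
    and c: "(\<integral>\<^sup>+z\<in>ball x t. ennreal (\<bar>u z - c\<bar> powr \<sigma>) \<partial>M) \<le> ennreal ((A * t powr s) powr \<sigma>) * emeasure M (ball x t)"
  shows "\<bar>u x - c\<bar> \<le> L * (1 + 2 / (1 - 2 powr - s)) * A * t powr s"
proof -
  define \<omega> where "\<omega> = 2 powr - s"
  have \<omega>: "0 < \<omega>" "\<omega> < 1" using s by (auto simp: \<omega>_def powr_less_one)
  define \<tau> where "\<tau> k = t / 2 ^ k" for k :: nat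
  have \<tau>0: "0 < \<tau> k" for k using t by (simp add: \<tau>_def)
  have \<tau>0': "\<tau> k \<noteq> 0" for k using \<tau>0[of k] by simp
  have \<tau>s: "\<tau> k powr s = t powr s * \<omega> ^ k" for k
  proof -
    have "\<omega> ^ k = 2 powr (- s * real k)" by (simp add: \<omega>_def powr_powr flip: powr_realpow)
    moreover have "(2 ^ k) powr s = 2 powr (s * real k)" by (simp add: powr_powr mult.commute flip: powr_realpow)
    moreover have "\<tau> k powr s = t powr s / (2 ^ k) powr s" using t by (simp add: \<tau>_def powr_divide)
    ultimately show ?thesis by (simp add: powr_minus divide_inverse)
  qed
  let ?P = "\<lambda>k c. (\<integral>\<^sup>+z\<in>ball x (\<tau> k). ennreal (\<bar>u z - c\<bar> powr \<sigma>) \<partial>M) \<le> ennreal ((A * \<tau> k powr s) powr \<sigma>) * emeasure M (ball x (\<tau> k))"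
  have "\<exists>c. ?P k c" for k using sharp_sigma_less_ennrealE[OF \<sigma> fin \<tau>0] by blast
  then obtain d where d: "\<And>k. ?P k (d k)" using choice[of ?P] by blast
  define b where "b k = (if k = 0 then c else d k)" for k
  have b: "?P k (b k)" for k using c d[of k] by (simp add: b_def \<tau>_def)
  have step: "\<bar>b k - b (Suc k)\<bar> \<le> 2 * L * A * t powr s * \<omega> ^ k" for k
  proof -
    have "\<bar>b k - b (Suc k)\<bar> \<le> L * (A * \<tau> k powr s + A * \<tau> (Suc k) powr s)"
    proof (rule minimizers_close[OF \<sigma> L(1,2) u _ _ \<tau>0 _ _ b b])
      have "\<tau> k = 2 * \<tau> (Suc k)" by (simp add: \<tau>_def)
      then show "measure M (ball x (\<tau> k)) \<le> C1 * 2 powr n * measure M (ball x (\<tau> (Suc k)))"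
        using doubling_real[OF \<tau>0[of "Suc k"], of 2 x] by simp
      show "ball x (\<tau> (Suc k)) \<subseteq> ball x (\<tau> k)" using \<open>\<tau> k = 2 * \<tau> (Suc k)\<close> \<tau>0[of "Suc k"] by auto
    qed (use A \<tau>0' in auto)
    also have "\<dots> = L * A * t powr s * \<omega> ^ k * (1 + \<omega>)" by (simp add: \<tau>s algebra_simps)
    also have "\<dots> \<le> L * A * t powr s * \<omega> ^ k * 2" using L A \<omega> by (intro mult_left_mono) auto
    finally show ?thesis by (simp add: mult_ac)
  qed
  have tele: "\<bar>b 0 - b k\<bar> \<le> 2 * L * A * t powr s * ((1 - \<omega> ^ k) / (1 - \<omega>))" for k
  proof (induction k)
    case (Suc k)
    have "\<bar>b 0 - b (Suc k)\<bar> \<le> 2 * L * A * t powr s * ((1 - \<omega> ^ k) / (1 - \<omega>) + \<omega> ^ k)"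
      using Suc step[of k] by (simp add: distrib_left)
    also have "(1 - \<omega> ^ k) / (1 - \<omega>) + \<omega> ^ k = (1 - \<omega> ^ Suc k) / (1 - \<omega>)"
      using \<omega> by (simp add: field_simps)
    finally show ?case .
  qed simp
  have "\<bar>u x - c\<bar> \<le> L * (1 + 2 / (1 - \<omega>)) * A * t powr s + e" if e: "0 < e" for e
  proof -
    obtain r0 where r0: "0 < r0" "\<And>r. 0 < r \<Longrightarrow> r < r0 \<Longrightarrow>
        measure M {z \<in> ball x r. e \<le> \<bar>u z - u x\<bar>} < 1 / 2 * measure M (ball x r)"
      using cont e by blast
    obtain k where k: "t / r0 < 2 ^ k" using real_arch_pow[of 2 "t / r0"] by auto
    then have "\<tau> k < r0" using r0(1) by (simp add: \<tau>_def field_simps)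
    let ?m = "measure M (ball x (\<tau> k))"
    let ?b' = "measure M {z \<in> ball x (\<tau> k). e \<le> \<bar>u z - u x\<bar>}"
    \<comment> \<open>Each bad set takes up at most half of the ball, one of them strictly less, so
      a common good point remains.\<close>
    have "\<exists>z\<in>ball x (\<tau> k). z \<notin> {z \<in> ball x (\<tau> k). L * (A * \<tau> k powr s) \<le> \<bar>u z - b k\<bar>} \<and> z \<notin> {z \<in> ball x (\<tau> k). e \<le> \<bar>u z - u x\<bar>}"
    proof (rule common_good_point[OF deviation_set(1)[OF u] deviation_set(1)[OF u] _ order_refl _ deviation_set(2)[OF u] deviation_set(2)[OF u]])
      have "0 < A * \<tau> k powr s" using A \<tau>0[of k] by simp
      then have "measure M {z \<in> ball x (\<tau> k). L * (A * \<tau> k powr s) \<le> \<bar>u z - b k\<bar>} \<le> L powr - \<sigma> * ?m"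
        by (rule measure_deviation_le[OF \<sigma> _ L(1) u b])
      also have "\<dots> \<le> 1 / 2 * ?m" by (intro mult_right_mono L(3)) simp
      finally show "measure M {z \<in> ball x (\<tau> k). L * (A * \<tau> k powr s) \<le> \<bar>u z - b k\<bar>} \<le> 1 / 2 * ?m" .
      show "1 / 2 * ?m + ?b' < ?m" using r0(2)[OF \<tau>0 \<open>\<tau> k < r0\<close>] by simp
    qed
    then obtain z where "\<bar>u z - b k\<bar> < L * (A * \<tau> k powr s)" "\<bar>u z - u x\<bar> < e" by (auto simp: not_le)
    then have 1: "\<bar>u x - b k\<bar> \<le> e + L * (A * \<tau> k powr s)" by linarith
    have "\<omega> ^ k \<le> 1" using \<omega> by (simp add: power_le_one)
    then have "L * (A * \<tau> k powr s) \<le> L * (A * (t powr s * 1))"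
      unfolding \<tau>s using L A by (intro mult_left_mono) auto
    moreover have "2 * L * A * t powr s * ((1 - \<omega> ^ k) / (1 - \<omega>)) \<le> 2 * L * A * t powr s * (1 / (1 - \<omega>))"
      using L A \<omega> by (intro mult_left_mono divide_right_mono) auto
    moreover have "\<bar>c - b k\<bar> \<le> 2 * L * A * t powr s * ((1 - \<omega> ^ k) / (1 - \<omega>))" using tele[of k] by (simp add: b_def)
    ultimately have "\<bar>u x - c\<bar> \<le> e + L * (A * (t powr s * 1)) + 2 * L * A * t powr s * (1 / (1 - \<omega>))"
      using 1 by linarith
    then show ?thesis by (simp add: algebra_simps)
  qed
  then show ?thesis unfolding \<omega>_def by (rule field_le_epsilon)
qed

text \<open>With d the distance of \<open>x\<close> and \<open>y\<close>, the path is
  \<open>u x\<close>, a constant on \<open>ball x (2 * d)\<close>, a constant on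
  \<open>ball y d\<close>, \<open>u y\<close>. The second ball lies in the first, which lies in
  \<open>ball y (3 * d)\<close>. Strict real bounds \<open>A\<close> and \<open>B\<close> replace
  the maximal functions, which may be infinite and whose infima may not be attained.\<close>

lemma sharp_sigma_controls_differences:
  assumes \<sigma>: "0 < \<sigma>" and s: "0 < s"
  shows "\<exists>K>0. \<forall>u\<in>borel_measurable M. \<exists>E\<in>null_sets M. \<forall>x\<in>-E. \<forall>y\<in>-E. \<forall>A B.
    sharp_sigma M s \<sigma> u x < ennreal A \<longrightarrow> sharp_sigma M s \<sigma> u y < ennreal B \<longrightarrow>
    \<bar>u x - u y\<bar> \<le> K * dist x y powr s * (A + B)"
proof -
  \<comment> \<open>\<open>D\<close> majorizes both measure ratios that occur, the factor 2 between
    dyadic balls and the factor 3 above; \<open>L\<close> is solved from L^(-\<sigma>) = 1 / (2 (D +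
    1)).\<close>
  define D where "D = C1 * 2 powr n + C1 * 3 powr n"
  have D: "0 < D" "C1 * 2 powr n \<le> D" "C1 * 3 powr n \<le> D" using C1_gt_1 by (auto simp: D_def intro: add_pos_pos)
  define L where "L = (2 * (D + 1)) powr (1 / \<sigma>)"
  have L0: "0 < L" using D by (simp add: L_def)
  have L\<sigma>: "L powr - \<sigma> = 1 / (2 * (D + 1))" using \<sigma> D by (simp add: L_def powr_powr powr_minus divide_inverse)
  have LD: "L powr - \<sigma> * (D' + 1) < 1" if "D' \<le> D" for D'
    using that D by (simp add: L\<sigma> divide_less_eq)
  have L2: "L powr - \<sigma> \<le> 1 / 2" using D by (simp add: L\<sigma> field_simps)
  define N where "N = L * (1 + 2 / (1 - 2 powr - s))"
  have "2 powr - s < 1" using s by (simp add: powr_less_one)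
  then have "0 < 1 + 2 / (1 - 2 powr - s)" by (simp add: add_pos_pos)
  then have N: "0 < N" using L0 by (simp add: N_def)
  define K where "K = (N + L) * 2 powr s"
  have "0 < K" using N L0 by (simp add: K_def)
  moreover have "\<exists>E\<in>null_sets M. \<forall>x\<in>-E. \<forall>y\<in>-E. \<forall>A B.
    sharp_sigma M s \<sigma> u x < ennreal A \<longrightarrow> sharp_sigma M s \<sigma> u y < ennreal B \<longrightarrow>
    \<bar>u x - u y\<bar> \<le> K * dist x y powr s * (A + B)" if u: "u \<in> borel_measurable M" for u
  proof -
    have "AE x in M. \<forall>e>0. \<exists>r0>0. \<forall>r. 0 < r \<and> r < r0 \<longrightarrow>
      measure M {z \<in> ball x r. e \<le> \<bar>u z - u x\<bar>} < 1 / 2 * measure M (ball x r)"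
      using u by (rule approximate_continuity) simp
    then obtain E where E: "E \<in> null_sets M" and cont: "\<And>x. x \<notin> E \<Longrightarrow> \<forall>e>0. \<exists>r0>0. \<forall>r. 0 < r \<and> r < r0 \<longrightarrow>
      measure M {z \<in> ball x r. e \<le> \<bar>u z - u x\<bar>} < 1 / 2 * measure M (ball x r)"
      by (rule AE_E3) auto
    have "\<bar>u x - u y\<bar> \<le> K * dist x y powr s * (A + B)"
      if x: "x \<notin> E" and y: "y \<notin> E" and A: "sharp_sigma M s \<sigma> u x < ennreal A"
        and B: "sharp_sigma M s \<sigma> u y < ennreal B" for x y A B
    proof (cases "x = y")
      case False
      define d where "d = dist x y"
      have d: "0 < d" using False by (simp add: d_def)
      have A0: "0 < A" and B0: "0 < B"
        using A B by (metis ennreal_less_zero_iff gr_zeroI not_less_zero less_trans)+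
      obtain c where c: "(\<integral>\<^sup>+z\<in>ball x (2 * d). ennreal (\<bar>u z - c\<bar> powr \<sigma>) \<partial>M) \<le>
          ennreal ((A * (2 * d) powr s) powr \<sigma>) * emeasure M (ball x (2 * d))"
        using sharp_sigma_less_ennrealE[OF \<sigma> A, of "2 * d"] d by auto
      obtain c' where c': "(\<integral>\<^sup>+z\<in>ball y d. ennreal (\<bar>u z - c'\<bar> powr \<sigma>) \<partial>M) \<le>
          ennreal ((B * d powr s) powr \<sigma>) * emeasure M (ball y d)"
        using sharp_sigma_less_ennrealE[OF \<sigma> B d] by auto
      have "\<bar>u x - c\<bar> \<le> N * A * (2 * d) powr s"
        unfolding N_def using d by (intro minimizer_near_value[OF \<sigma> s L0 LD L2 u A0 _ A cont[OF x] c] D) auto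
      moreover have "\<bar>u y - c'\<bar> \<le> N * B * d powr s"
        unfolding N_def by (intro minimizer_near_value[OF \<sigma> s L0 LD L2 u B0 d B cont[OF y] c'] D)
      moreover have "\<bar>c - c'\<bar> \<le> L * (A * (2 * d) powr s + B * d powr s)"
      proof (rule minimizers_close[OF \<sigma> L0 LD[OF D(3)] u _ _ d _ _ c c'])
        have "ball x (2 * d) \<subseteq> ball y (3 * d)"
        proof
          fix z assume "z \<in> ball x (2 * d)"
          then show "z \<in> ball y (3 * d)" using dist_triangle[of y z x] by (simp add: d_def dist_commute)
        qed
        then have "emeasure M (ball x (2 * d)) \<le> emeasure M (ball y (3 * d))" by (intro emeasure_mono) auto
        then show "measure M (ball x (2 * d)) \<le> C1 * 3 powr n * measure M (ball y d)"
          using doubling_real[OF d, of 3 y] by (simp add: emeasure_ball)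
        show "ball y d \<subseteq> ball x (2 * d)"
        proof
          fix z assume "z \<in> ball y d"
          then show "z \<in> ball x (2 * d)" using dist_triangle[of x z y] by (simp add: d_def)
        qed
      qed (use A0 B0 d in auto)
      ultimately have "\<bar>u x - u y\<bar> \<le> (N + L) * (A * (2 * d) powr s + B * d powr s)"
        by (simp add: algebra_simps)
      also have "\<dots> \<le> (N + L) * (A * (2 * d) powr s + B * (2 * d) powr s)"
        using N L0 A0 B0 d s by (intro mult_left_mono add_left_mono powr_mono2) auto
      also have "\<dots> = K * d powr s * (A + B)"
        using d by (simp add: K_def powr_mult algebra_simps)
      finally show ?thesis by (simp add: d_def)
    qed simp
    then show ?thesis using E by (intro bexI[of _ E]) auto
  qed
  ultimately show ?thesis by blast
qed

end

section \<open>Norms\<close>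

lemma enn_powr_mono: "x \<le> y \<Longrightarrow> 0 \<le> a \<Longrightarrow> enn_powr x a \<le> enn_powr y a"
  by (cases x; cases y) (auto simp: enn_powr_ennreal enn_powr_top top_unique intro!: powr_mono2)

lemma enn_powr_cmult: "0 < c \<Longrightarrow> enn_powr (ennreal c * x) a = ennreal (c powr a) * enn_powr x a"
  by (cases x) (auto simp: enn_powr_ennreal enn_powr_top ennreal_mult[symmetric] powr_mult ennreal_mult_top)

lemma enn_powr_measurable [measurable]:
  assumes [measurable]: "f \<in> borel_measurable M"
  shows "(\<lambda>x. enn_powr (f x) a) \<in> borel_measurable M"
  unfolding enn_powr_def by measurable

lemma ennreal_mult_le_iff_swap:
  fixes x y :: ennreal
  assumes "0 < c"
  shows "ennreal (1 / c) * x \<le> y \<longleftrightarrow> x \<le> ennreal c * y"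
  using assms
  by (cases x; cases y) (auto simp: ennreal_mult[symmetric] field_simps ennreal_mult_top top_unique)

lemma Lp_norm_infinity: "Lp_norm M \<infinity> f = esssup M f"
  by (simp add: Lp_norm_def)

lemma Lp_norm_ennreal:
  "0 < P \<Longrightarrow> Lp_norm M (ennreal P) f = enn_powr (\<integral>\<^sup>+x. enn_powr (f x) P \<partial>M) (1 / P)"
  by (simp add: Lp_norm_def)

lemma exponent_cases:
  assumes "0 < (p::ennreal)"
  obtains (inf) "p = \<infinity>" | (fin) P where "p = ennreal P" "0 < P"
  using assms by (cases p) (auto simp: ennreal_less_zero_iff)

lemma Lp_norm_mono_AE:
  assumes p: "0 < p" and f: "f \<in> borel_measurable M" and le: "AE x in M. f x \<le> g x"
  shows "Lp_norm M p f \<le> Lp_norm M p g"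
  using p
proof (cases rule: exponent_cases)
  case inf
  then show ?thesis using f le by (simp add: Lp_norm_infinity esssup_AE_mono del: infinity_ennreal_def)
next
  case (fin P)
  have "(\<integral>\<^sup>+x. enn_powr (f x) P \<partial>M) \<le> (\<integral>\<^sup>+x. enn_powr (g x) P \<partial>M)"
    using le fin(2) by (intro nn_integral_mono_AE) (auto elim!: eventually_mono intro: enn_powr_mono)
  then show ?thesis using fin by (simp add: Lp_norm_ennreal enn_powr_mono)
qed

lemma Lp_norm_cmult_le:
  assumes p: "0 < p" and f: "f \<in> borel_measurable M" and c: "0 < c"
  shows "Lp_norm M p (\<lambda>x. ennreal c * f x) \<le> ennreal c * Lp_norm M p f"
  using p
proof (cases rule: exponent_cases)
  case inf
  have "AE x in M. ennreal c * f x \<le> ennreal c * esssup M f"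
    using esssup_AE[of f M] by (auto elim!: eventually_mono intro: mult_left_mono)
  then show ?thesis using f inf by (auto simp: Lp_norm_infinity simp del: infinity_ennreal_def)
next
  case (fin P)
  then show ?thesis using f c
    by (simp add: Lp_norm_ennreal enn_powr_cmult nn_integral_cmult powr_powr)
qed

lemma Lp_norm_finite_imp_AE:
  assumes p: "0 < p" and f: "f \<in> borel_measurable M" and fin: "Lp_norm M p f < \<infinity>"
  shows "AE x in M. f x \<noteq> \<infinity>"
  using p
proof (cases rule: exponent_cases)
  case inf
  then have "esssup M f < top" using fin by (simp add: Lp_norm_def)
  then show ?thesis using esssup_AE[of f M] by (auto elim!: eventually_mono)
next
  case (fin P)
  then have "(\<integral>\<^sup>+x. enn_powr (f x) P \<partial>M) \<noteq> \<infinity>"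
    using \<open>Lp_norm M p f < \<infinity>\<close> by (auto simp: Lp_norm_ennreal enn_powr_top)
  then have "AE x in M. enn_powr (f x) P \<noteq> \<infinity>"
    using f by (intro nn_integral_noteq_infinite) measurable
  then show ?thesis by (auto elim!: eventually_mono simp: enn_powr_top)
qed

text \<open>For p < n / s, clearing denominators in \<sigma> < n p / (n - p s) gives the claim. For
  larger p every finite \<sigma> is allowed, and n \<sigma> / (n + \<sigma> s) stays below n /
  s.\<close>

lemma exponent_below_p_star:
  assumes "0 < s" "0 < n" "0 < \<sigma>" and lt: "ennreal \<sigma> < p_star n p s"
  shows "ennreal (n * \<sigma> / (n + \<sigma> * s)) < p"
proof -
  have pos: "0 < n + \<sigma> * s" using assms by (simp add: add_pos_pos)
  show ?thesis
  proof (cases "p < ennreal (n / s)")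
    case True
    then obtain P where P: "p = ennreal P" "0 \<le> P" by (cases p) (auto simp: top_unique)
    then have "P < n / s" using True by (simp add: ennreal_less_iff)
    then have d: "0 < n - P * s" using assms by (simp add: field_simps)
    have "\<sigma> < n * P / (n - P * s)"
      using lt True P assms by (simp add: p_star_def ennreal_less_iff)
    then have "n * \<sigma> < P * (n + \<sigma> * s)" using d by (simp add: field_simps)
    then have "n * \<sigma> / (n + \<sigma> * s) < P" using pos by (simp add: field_simps)
    then show ?thesis using P assms pos by (simp add: ennreal_less_iff)
  next
    case False
    have "n * (\<sigma> * s) < n * (n + \<sigma> * s)" using assms by simp
    then have "n * \<sigma> / (n + \<sigma> * s) < n / s" using pos assms by (simp add: field_simps)
    then have "ennreal (n * \<sigma> / (n + \<sigma> * s)) < ennreal (n / s)"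
      using assms pos by (simp add: ennreal_less_iff)
    then show ?thesis using False by (simp add: not_less order_less_le_trans)
  qed
qed

context doubling_metric_measure begin

section \<open>Comparison of the norms\<close>

lemma sharp_sigma_le_maximal:
  assumes s: "0 < s" and \<sigma>: "0 < \<sigma>"
  defines "q \<equiv> n * \<sigma> / (n + \<sigma> * s)"
  shows "\<exists>K>0. \<forall>u g x k. u \<in> borel_measurable M \<and> g \<in> hajlasz_gradients M s u \<and> 0 \<le> k \<and>
    maximal (\<lambda>z. ennreal (g z powr q)) x \<le> ennreal (k powr q) \<longrightarrow> sharp_sigma M s \<sigma> u x \<le> ennreal (K * k)"
proof -
  have q: "0 < q" unfolding q_def using s \<sigma> n_pos by (intro divide_pos_pos mult_pos_pos add_pos_pos)
  obtain K where K: "0 < K" and poinc: "\<forall>u g x r A. u \<in> borel_measurable M \<and> g \<in> hajlasz_gradients M s u \<and> 0 < r \<and> 0 < A \<and>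
     (\<integral>\<^sup>+z\<in>ball x (2 * r). ennreal (g z powr q) \<partial>M) \<le> ennreal (A powr q) * emeasure M (ball x (2 * r)) \<longrightarrow>
     (\<exists>c. (\<integral>\<^sup>+z\<in>ball x r. ennreal (\<bar>u z - c\<bar> powr \<sigma>) \<partial>M) \<le>
        ennreal ((K * r powr s * A) powr \<sigma>) * emeasure M (ball x r))"
    using hajlasz_poincare[OF s \<sigma>] unfolding q_def by (elim exE conjE)
  have "sharp_sigma M s \<sigma> u x \<le> ennreal (K * k)"
    if u: "u \<in> borel_measurable M" and g: "g \<in> hajlasz_gradients M s u" and k: "0 \<le> k"
      and max: "maximal (\<lambda>z. ennreal (g z powr q)) x \<le> ennreal (k powr q)" for u g x k
  proof -
    have Kk: "0 \<le> K * k" using K k by simp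
    show ?thesis
      unfolding sharp_sigma_le_iff[OF \<sigma> Kk]
    proof (intro allI impI)
      fix t a' :: real assume t: "0 < t" and a': "K * k < a'"
      \<comment> \<open>The slack in \<open>sharp_sigma_le_iff\<close> provides an \<open>A\<close>
        strictly above \<open>k\<close>, hence positive even when \<open>k\<close> is 0.\<close>
      define A where "A = a' / K"
      have A: "k < A" "a' = K * A" using a' K by (auto simp: A_def field_simps)
      have t2: "0 < 2 * t" using t by simp
      have "(\<integral>\<^sup>+z\<in>ball x (2 * t). ennreal (g z powr q) \<partial>M) \<le> ennreal (k powr q) * emeasure M (ball x (2 * t))"
        using max t2 unfolding maximal_le_iff by blast
      also have "\<dots> \<le> ennreal (A powr q) * emeasure M (ball x (2 * t))"
        using A k q by (intro mult_right_mono ennreal_leI powr_mono2) auto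
      finally have int: "(\<integral>\<^sup>+z\<in>ball x (2 * t). ennreal (g z powr q) \<partial>M) \<le>
          ennreal (A powr q) * emeasure M (ball x (2 * t))" .
      have "0 < A" using A(1) k by linarith
      have "\<exists>c. (\<integral>\<^sup>+z\<in>ball x t. ennreal (\<bar>u z - c\<bar> powr \<sigma>) \<partial>M) \<le>
          ennreal ((K * t powr s * A) powr \<sigma>) * emeasure M (ball x t)"
        by (rule poinc[rule_format, OF conjI[OF u conjI[OF g conjI[OF t conjI[OF \<open>0 < A\<close> int]]]]])
      then show "\<exists>c. (\<integral>\<^sup>+z\<in>ball x t. ennreal (\<bar>u z - c\<bar> powr \<sigma>) \<partial>M) \<le>
          ennreal ((a' * t powr s) powr \<sigma>) * emeasure M (ball x t)"
        by (simp only: A(2) mult_ac)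
    qed
  qed
  then show ?thesis using K by blast
qed

lemma Lp_norm_sharp_sigma_le_gradient:
  assumes s: "0 < s" and \<sigma>: "0 < \<sigma>" and p: "0 < p" and q: "ennreal (n * \<sigma> / (n + \<sigma> * s)) < p"
  shows "\<exists>C>0. \<forall>u\<in>borel_measurable M. \<forall>g\<in>hajlasz_gradients M s u.
    Lp_norm M p (sharp_sigma M s \<sigma> u) \<le> ennreal C * Lp_norm M p (\<lambda>x. ennreal (g x))"
proof -
  define q' where "q' = n * \<sigma> / (n + \<sigma> * s)"
  have q': "0 < q'" unfolding q'_def using s \<sigma> n_pos by (intro divide_pos_pos mult_pos_pos add_pos_pos)
  obtain K where K: "0 < K" and K_le: "\<And>u g x k. u \<in> borel_measurable M \<Longrightarrow> g \<in> hajlasz_gradients M s u \<Longrightarrow> 0 \<le> k \<Longrightarrow>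
    maximal (\<lambda>z. ennreal (g z powr q')) x \<le> ennreal (k powr q') \<Longrightarrow> sharp_sigma M s \<sigma> u x \<le> ennreal (K * k)"
    using sharp_sigma_le_maximal[OF s \<sigma>] unfolding q'_def by blast
  show ?thesis
    using p
  proof (cases rule: exponent_cases)
    case inf
    have "esssup M (sharp_sigma M s \<sigma> u) \<le> ennreal K * esssup M (\<lambda>x. ennreal (g x))"
      if u: "u \<in> borel_measurable M" and g: "g \<in> hajlasz_gradients M s u" for u g
    proof (cases "esssup M (\<lambda>x. ennreal (g x))")
      case (real k)
      have g0: "0 \<le> g z" for z using g by (auto simp: hajlasz_gradients_def)
      have AE: "AE z in M. g z \<le> k"
        using esssup_AE[of "\<lambda>x. ennreal (g x)" M] real by (auto elim!: eventually_mono)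
      \<comment> \<open>In the endpoint case the essential bound on \<open>g\<close> passes to every
        average, so no maximal theorem is involved.\<close>
      have "maximal (\<lambda>z. ennreal (g z powr q')) x \<le> ennreal (k powr q')" for x
        unfolding maximal_le_iff
      proof (intro allI impI)
        fix t :: real
        have "(\<integral>\<^sup>+z\<in>ball x t. ennreal (g z powr q') \<partial>M) \<le> (\<integral>\<^sup>+z. ennreal (k powr q') * indicator (ball x t) z \<partial>M)"
          using AE g0 q' by (intro nn_integral_mono_AE)
            (auto elim!: eventually_mono intro!: mult_right_mono ennreal_leI powr_mono2)
        then show "(\<integral>\<^sup>+z\<in>ball x t. ennreal (g z powr q') \<partial>M) \<le> ennreal (k powr q') * emeasure M (ball x t)"
          by (simp add: nn_integral_cmult_indicator)
      qed
      then have "sharp_sigma M s \<sigma> u x \<le> ennreal (K * k)" for x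
        by (rule K_le[OF u g real(1)])
      then have "esssup M (sharp_sigma M s \<sigma> u) \<le> ennreal (K * k)"
        using sharp_sigma_measurable[OF s \<sigma> u] by auto
      then show ?thesis using real K by (simp add: ennreal_mult)
    next
      case top
      then show ?thesis using K by (simp add: ennreal_mult_top)
    qed
    then show ?thesis using K inf by (auto simp: Lp_norm_infinity simp del: infinity_ennreal_def)
  next
    case (fin P)
    \<comment> \<open>The maximal theorem is applied to g^q' with this exponent; r > 1 is the
      hypothesis q' < P, and (g^q')^r = g^P.\<close>
    define r where "r = P / q'"
    have r: "1 < r" using q fin q' by (simp add: r_def q'_def[symmetric] ennreal_less_iff)
    define D where "D = C1 * 5 powr n * 2 powr r * r / (r - 1)"
    have D: "0 < D" using r C1_gt_1 by (simp add: D_def)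
    define C where "C = (K powr P * D) powr (1 / P)"
    have C: "0 < C" using K D by (simp add: C_def)
    have "Lp_norm M p (sharp_sigma M s \<sigma> u) \<le> ennreal C * Lp_norm M p (\<lambda>x. ennreal (g x))"
      if u: "u \<in> borel_measurable M" and g: "g \<in> hajlasz_gradients M s u" for u g
    proof -
      have g0: "0 \<le> g z" for z using g by (auto simp: hajlasz_gradients_def)
      have gm [measurable]: "g \<in> borel_measurable M" using g by (auto simp: hajlasz_gradients_def)
      let ?F = "maximal (\<lambda>z. ennreal (g z powr q'))"
      have Fm: "?F \<in> borel_measurable M" by (rule maximal_measurable) measurable
      have pt: "enn_powr (sharp_sigma M s \<sigma> u x) P \<le> ennreal (K powr P) * enn_powr (?F x) r" for x
      proof (cases "?F x")
        case (real m)
        have "sharp_sigma M s \<sigma> u x \<le> ennreal (K * m powr (1 / q'))"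
          using real q' by (intro K_le[OF u g]) (auto simp: powr_powr)
        then have "enn_powr (sharp_sigma M s \<sigma> u x) P \<le> enn_powr (ennreal (K * m powr (1 / q'))) P"
          using fin by (intro enn_powr_mono) auto
        also have "\<dots> = ennreal (K powr P * m powr r)"
          using K by (simp add: enn_powr_ennreal powr_mult powr_powr r_def)
        finally show ?thesis using real by (simp add: enn_powr_ennreal ennreal_mult)
      next
        case top
        then show ?thesis using K by (simp add: enn_powr_top ennreal_mult_top)
      qed
      have "(\<integral>\<^sup>+x. enn_powr (sharp_sigma M s \<sigma> u x) P \<partial>M) \<le> (\<integral>\<^sup>+x. ennreal (K powr P) * enn_powr (?F x) r \<partial>M)"
        by (intro nn_integral_mono pt)
      also have "\<dots> = ennreal (K powr P) * (\<integral>\<^sup>+x. enn_powr (?F x) r \<partial>M)"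
        using Fm by (intro nn_integral_cmult) measurable
      also have "\<dots> \<le> ennreal (K powr P) * (ennreal D * (\<integral>\<^sup>+x. ennreal ((g x powr q') powr r) \<partial>M))"
        unfolding D_def by (intro mult_left_mono maximal_strong_type r) (auto)
      also have "(\<integral>\<^sup>+x. ennreal ((g x powr q') powr r) \<partial>M) = (\<integral>\<^sup>+x. enn_powr (ennreal (g x)) P \<partial>M)"
        using q' g0 by (intro nn_integral_cong) (simp add: enn_powr_ennreal powr_powr r_def)
      also have "ennreal (K powr P) * (ennreal D * (\<integral>\<^sup>+x. enn_powr (ennreal (g x)) P \<partial>M)) =
          ennreal (K powr P * D) * (\<integral>\<^sup>+x. enn_powr (ennreal (g x)) P \<partial>M)"
        using D by (simp add: ennreal_mult mult.assoc)
      finally have "enn_powr (\<integral>\<^sup>+x. enn_powr (sharp_sigma M s \<sigma> u x) P \<partial>M) (1 / P) \<le>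
          enn_powr (ennreal (K powr P * D) * (\<integral>\<^sup>+x. enn_powr (ennreal (g x)) P \<partial>M)) (1 / P)"
        using fin by (intro enn_powr_mono) auto
      also have "\<dots> = ennreal C * enn_powr (\<integral>\<^sup>+x. enn_powr (ennreal (g x)) P \<partial>M) (1 / P)"
        unfolding C_def using K D by (intro enn_powr_cmult) simp
      finally show ?thesis using fin by (simp add: Lp_norm_ennreal)
    qed
    then show ?thesis using C by blast
  qed
qed

lemma hajlasz_norm_le_sharp_sigma:
  assumes s: "0 < s" and \<sigma>: "0 < \<sigma>" and p: "0 < p"
  shows "\<exists>C>0. \<forall>u\<in>borel_measurable M. hajlasz_norm M s p u \<le> ennreal C * Lp_norm M p (sharp_sigma M s \<sigma> u)"
proof -
  obtain K where K: "0 < K" and ctl: "\<forall>u\<in>borel_measurable M. \<exists>E\<in>null_sets M. \<forall>x\<in>-E. \<forall>y\<in>-E. \<forall>A B.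
    sharp_sigma M s \<sigma> u x < ennreal A \<longrightarrow> sharp_sigma M s \<sigma> u y < ennreal B \<longrightarrow>
    \<bar>u x - u y\<bar> \<le> K * dist x y powr s * (A + B)"
    using sharp_sigma_controls_differences[OF \<sigma> s] by blast
  have "hajlasz_norm M s p u \<le> ennreal K * Lp_norm M p (sharp_sigma M s \<sigma> u)" if u: "u \<in> borel_measurable M" for u
  proof (cases "Lp_norm M p (sharp_sigma M s \<sigma> u) = \<infinity>")
    case True
    then show ?thesis using K by (simp add: ennreal_mult_top)
  next
    case False
    let ?S = "sharp_sigma M s \<sigma> u"
    have Sm: "?S \<in> borel_measurable M" by (rule sharp_sigma_measurable[OF s \<sigma> u])
    have "AE x in M. ?S x \<noteq> \<infinity>"
      using False by (intro Lp_norm_finite_imp_AE[OF p Sm]) (simp add: less_top)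
    then obtain F where F: "F \<in> null_sets M" "\<And>x. x \<notin> F \<Longrightarrow> ?S x \<noteq> \<infinity>" by (rule AE_E3) auto
    obtain E where E: "E \<in> null_sets M" and diff: "\<And>x y A B. x \<notin> E \<Longrightarrow> y \<notin> E \<Longrightarrow>
      ?S x < ennreal A \<Longrightarrow> ?S y < ennreal B \<Longrightarrow> \<bar>u x - u y\<bar> \<le> K * dist x y powr s * (A + B)"
      using ctl u by (metis ComplI)
    define g where "g x = K * enn2real (?S x)" for x
    have "\<bar>u x - u y\<bar> \<le> dist x y powr s * (g x + g y)" if x: "x \<notin> E \<union> F" and y: "y \<notin> E \<union> F" for x y
    proof (rule field_le_epsilon)
      fix e :: real assume e: "0 < e"
      let ?d = "K * dist x y powr s"
      \<comment> \<open>The difference estimate wants strict upper bounds, so both values of the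
        maximal function are raised by \<open>e'\<close>, which costs \<open>2 * ?d * e'\<close>, at
        most \<open>e\<close>. The added 1 keeps the denominator positive when \<open>x\<close> and
        \<open>y\<close> coincide.\<close>
      define e' where "e' = e / (2 * ?d + 1)"
      have d: "0 \<le> ?d" using K by simp
      then have e': "0 < e'" using e by (simp add: e'_def add_nonneg_pos)
      have less: "?S z < ennreal (enn2real (?S z) + e')" if z: "z \<notin> F" for z
      proof -
        have "?S z = ennreal (enn2real (?S z))" using F(2)[OF z] by (simp add: less_top)
        also have "\<dots> < ennreal (enn2real (?S z) + e')" using e' by (simp add: ennreal_less_iff)
        finally show ?thesis .
      qed
      have "\<bar>u x - u y\<bar> \<le> ?d * (enn2real (?S x) + e' + (enn2real (?S y) + e'))"
        using x y by (intro diff less) auto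
      also have "\<dots> = dist x y powr s * (g x + g y) + 2 * ?d * e'" by (simp add: g_def algebra_simps)
      also have "2 * ?d * e' \<le> (2 * ?d + 1) * e'" using e' by (intro mult_right_mono) auto
      also have "(2 * ?d + 1) * e' = e" using d by (simp add: e'_def add_nonneg_pos less_imp_neq[symmetric])
      finally show "\<bar>u x - u y\<bar> \<le> dist x y powr s * (g x + g y) + e" by simp
    qed
    moreover have "g \<in> borel_measurable M" unfolding g_def using Sm by measurable
    moreover have "0 \<le> g x" for x using K by (simp add: g_def)
    moreover have "E \<union> F \<in> null_sets M" using E F(1) by auto
    ultimately have g: "g \<in> hajlasz_gradients M s u" unfolding hajlasz_gradients_def by blast
    have "hajlasz_norm M s p u \<le> Lp_norm M p (\<lambda>x. ennreal (g x))"
      unfolding hajlasz_norm_def by (rule INF_lower[OF g])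
    also have "\<dots> \<le> Lp_norm M p (\<lambda>x. ennreal K * ?S x)"
    proof (rule Lp_norm_mono_AE[OF p])
      have "ennreal (enn2real (?S x)) \<le> ?S x" for x by (cases "?S x") auto
      then show "AE x in M. ennreal (g x) \<le> ennreal K * ?S x"
        using K by (intro AE_I2) (simp add: g_def ennreal_mult mult_left_mono)
    qed (use \<open>g \<in> borel_measurable M\<close> in measurable)
    also have "\<dots> \<le> ennreal K * Lp_norm M p ?S" by (rule Lp_norm_cmult_le[OF p Sm K])
    finally show ?thesis .
  qed
  then show ?thesis using K by blast
qed

lemma hajlasz_norm_equiv_sharp_sigma:
  assumes s: "0 < s" and \<sigma>: "0 < \<sigma>" and p: "0 < p" and q: "ennreal (n * \<sigma> / (n + \<sigma> * s)) < p"
  shows "\<exists>C C'. 0 < C \<and> 0 < C' \<and> (\<forall>u\<in>borel_measurable M.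
    hajlasz_norm M s p u \<le> ennreal C * Lp_norm M p (sharp_sigma M s \<sigma> u) \<and>
    Lp_norm M p (sharp_sigma M s \<sigma> u) \<le> ennreal C' * hajlasz_norm M s p u)"
proof -
  obtain C where C: "0 < C" "\<And>u. u \<in> borel_measurable M \<Longrightarrow> hajlasz_norm M s p u \<le> ennreal C * Lp_norm M p (sharp_sigma M s \<sigma> u)"
    using hajlasz_norm_le_sharp_sigma[OF s \<sigma> p] by blast
  obtain C' where C': "0 < C'" "\<And>u g. u \<in> borel_measurable M \<Longrightarrow> g \<in> hajlasz_gradients M s u \<Longrightarrow>
      Lp_norm M p (sharp_sigma M s \<sigma> u) \<le> ennreal C' * Lp_norm M p (\<lambda>x. ennreal (g x))"
    using Lp_norm_sharp_sigma_le_gradient[OF s \<sigma> p q] by blast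
  have "Lp_norm M p (sharp_sigma M s \<sigma> u) \<le> ennreal C' * hajlasz_norm M s p u" if u: "u \<in> borel_measurable M" for u
  proof -
    \<comment> \<open>With the constant on the left, the infimum over gradients can be taken
      directly, including the case of no gradient.\<close>
    have "ennreal (1 / C') * Lp_norm M p (sharp_sigma M s \<sigma> u) \<le> hajlasz_norm M s p u"
      unfolding hajlasz_norm_def using C' u by (intro INF_greatest) (simp add: ennreal_mult_le_iff_swap)
    then show ?thesis using C'(1) by (simp add: ennreal_mult_le_iff_swap)
  qed
  then show ?thesis using C C'(1) by (intro exI[of _ C] exI[of _ C']) simp
qed

section \<open>The sharp maximal function with averages\<close>

lemma sharp_le_iff:
  assumes a: "0 \<le> a"
  shows "sharp M s u x \<le> ennreal a \<longleftrightarrow> (\<forall>t>0. (\<integral>\<^sup>+z\<in>ball x t. ennreal \<bar>u z - avg M (ball x t) u\<bar> \<partial>M) \<le>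
    ennreal (a * t powr s) * emeasure M (ball x t))"
  unfolding sharp_def SUP_le_iff nn_avg_def
  using a ball_nonzero ball_not_top by (auto simp: ennreal_powr_mult_le_iff ennreal_divide_le_iff)

text \<open>For \<open>sharp\<close> the subtracted constants are prescribed, so the Fatou argument
  needs them to converge. Dominated convergence handles numerator and denominator alike, with
  integrands \<open>u\<close> and 1.\<close>

lemma avg_continuous:
  assumes u: "locally_integrable M u" and X: "X \<longlonglongrightarrow> x" and t: "0 < t"
  shows "(\<lambda>k. avg M (ball (X k) (t - dist x (X k))) u) \<longlonglongrightarrow> avg M (ball x t) u"
proof -
  let ?B = "\<lambda>k. ball (X k) (t - dist x (X k))"
  have lim: "(\<lambda>k. LINT z|M. indicator (?B k) z *\<^sub>R v z) \<longlonglongrightarrow> (LINT z|M. indicator (ball x t) z *\<^sub>R v z)"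
    if v: "set_integrable M (ball x t) v" "v \<in> borel_measurable M" for v :: "'a \<Rightarrow> real"
  proof (rule integral_dominated_convergence[where w = "\<lambda>z. norm (indicator (ball x t) z *\<^sub>R v z)"])
    show "AE z in M. (\<lambda>k. indicator (?B k) z *\<^sub>R v z) \<longlonglongrightarrow> indicator (ball x t) z *\<^sub>R v z"
    proof (rule AE_I2)
      fix z
      have "\<forall>\<^sub>F k in sequentially. indicator (?B k) z *\<^sub>R v z = indicator (ball x t) z *\<^sub>R v z"
      proof (cases "z \<in> ball x t")
        case True
        show ?thesis
          using eventually_in_balls[OF X True] by (rule eventually_mono) (use True in \<open>simp add: indicator_def\<close>)
      next
        case False
        then have "z \<notin> ?B k" for k using ball_minus_dist_subset[of "X k" t x] by blast
        then show ?thesis using False by (simp add: indicator_def)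
      qed
      then show "(\<lambda>k. indicator (?B k) z *\<^sub>R v z) \<longlonglongrightarrow> indicator (ball x t) z *\<^sub>R v z"
        by (rule tendsto_eventually)
    qed
    show "AE z in M. norm (indicator (?B k) z *\<^sub>R v z) \<le> norm (indicator (ball x t) z *\<^sub>R v z)" for k
      using ball_minus_dist_subset[of "X k" t x] by (intro AE_I2) (auto simp: indicator_def)
    show "integrable M (\<lambda>z. norm (indicator (ball x t) z *\<^sub>R v z))"
      using v(1) by (simp only: set_integrable_def integrable_norm)
  qed (use v(2) in measurable)
  have um: "u \<in> borel_measurable M" "set_integrable M (ball x t) u"
    using u t by (auto simp: locally_integrable_def)
  have int1: "set_integrable M (ball x t) (\<lambda>_. 1::real)"
    unfolding set_integrable_def using ball_not_top[of x t] by (simp add: less_top)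
  have "(\<lambda>k. measure M (?B k)) \<longlonglongrightarrow> measure M (ball x t)"
    using lim[OF int1] by simp
  then show ?thesis
    unfolding avg_def set_lebesgue_integral_def
    using ball_measure_pos[OF t, of x] by (intro tendsto_divide lim um) auto
qed

lemma sharp_measurable:
  assumes s: "0 < s" and u: "locally_integrable M u"
  shows "sharp M s u \<in> borel_measurable M"
proof (rule borel_measurable_closed_sublevel)
  fix X :: "nat \<Rightarrow> 'a" and x and a :: real
  assume X: "X \<longlonglongrightarrow> x" and a: "0 \<le> a" and le: "\<And>k. sharp M s u (X k) \<le> ennreal a"
  have um: "u \<in> borel_measurable M" using u by (auto simp: locally_integrable_def)
  have "(\<integral>\<^sup>+z\<in>ball x t. ennreal \<bar>u z - avg M (ball x t) u\<bar> \<partial>M) \<le> ennreal (a * t powr s) * emeasure M (ball x t)"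
    if t: "0 < t" for t
  proof (rule fatou_balls[OF X, of "\<lambda>k z. ennreal \<bar>u z - avg M (ball (X k) (t - dist x (X k))) u\<bar>"])
    show "(\<lambda>k. ennreal \<bar>u z - avg M (ball (X k) (t - dist x (X k))) u\<bar>) \<longlonglongrightarrow> ennreal \<bar>u z - avg M (ball x t) u\<bar>" for z
      by (intro tendsto_ennrealI tendsto_rabs tendsto_diff tendsto_const avg_continuous u X t)
    fix k assume r: "0 < t - dist x (X k)"
    have "(\<integral>\<^sup>+z\<in>ball (X k) (t - dist x (X k)). ennreal \<bar>u z - avg M (ball (X k) (t - dist x (X k))) u\<bar> \<partial>M) \<le>
        ennreal (a * (t - dist x (X k)) powr s) * emeasure M (ball (X k) (t - dist x (X k)))"
      using le[of k] r unfolding sharp_le_iff[OF a] by blast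
    also have "\<dots> \<le> ennreal (a * t powr s) * emeasure M (ball x t)"
      using r a s by (intro mult_mono emeasure_mono ball_minus_dist_subset ennreal_leI powr_mono2 mult_left_mono) auto
    finally show "(\<integral>\<^sup>+z\<in>ball (X k) (t - dist x (X k)). ennreal \<bar>u z - avg M (ball (X k) (t - dist x (X k))) u\<bar> \<partial>M) \<le>
        ennreal (a * t powr s) * emeasure M (ball x t)" .
  qed (use um in measurable)
  then show "sharp M s u x \<le> ennreal a" unfolding sharp_le_iff[OF a] by blast
qed

lemma sharp_sigma_1_le_sharp: "sharp_sigma M s 1 u x \<le> sharp M s u x"
proof (cases "sharp M s u x")
  case (real a)
  then have int: "(\<integral>\<^sup>+z\<in>ball x t. ennreal \<bar>u z - avg M (ball x t) u\<bar> \<partial>M) \<le> ennreal (a * t powr s) * emeasure M (ball x t)"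
    if "0 < t" for t
    using sharp_le_iff[OF real(1), of s u x] that by auto
  have "sharp_sigma M s 1 u x \<le> ennreal a"
    unfolding sharp_sigma_le_iff[OF zero_less_one real(1)]
  proof (intro allI impI)
    fix t a' :: real assume t: "0 < t" and a': "a < a'"
    have "(\<integral>\<^sup>+z\<in>ball x t. ennreal \<bar>u z - avg M (ball x t) u\<bar> \<partial>M) \<le> ennreal (a' * t powr s) * emeasure M (ball x t)"
      using a' by (intro order_trans[OF int[OF t]] mult_right_mono ennreal_leI) auto
    then show "\<exists>c. (\<integral>\<^sup>+z\<in>ball x t. ennreal (\<bar>u z - c\<bar> powr 1) \<partial>M) \<le> ennreal ((a' * t powr s) powr 1) * emeasure M (ball x t)"
      using a' real(1) by (intro exI[of _ "avg M (ball x t) u"]) simp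
  qed
  then show ?thesis using real by simp
qed simp

text \<open>For any c the average differs from c by at most the mean of |u - c|, and the triangle
  inequality doubles that mean.\<close>

lemma sharp_le_sharp_sigma_1:
  assumes u: "locally_integrable M u"
  shows "sharp M s u x \<le> 2 * sharp_sigma M s 1 u x"
proof (cases "sharp_sigma M s 1 u x")
  case (real a)
  have um: "u \<in> borel_measurable M" using u by (auto simp: locally_integrable_def)
  have "sharp M s u x \<le> ennreal (2 * a) + ennreal e" if e: "0 < e" for e
  proof -
    define a' where "a' = a + e / 2"
    have a': "a < a'" "0 \<le> 2 * a'" using e real(1) by (auto simp: a'_def)
    have "sharp M s u x \<le> ennreal (2 * a')"
      unfolding sharp_le_iff[OF a'(2)]
    proof (intro allI impI)
      fix t :: real assume t: "0 < t"
      let ?B = "ball x t"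
      let ?m = "avg M ?B u"
      have mB: "0 < measure M ?B" by (rule ball_measure_pos[OF t])
      obtain c where c: "(\<integral>\<^sup>+z\<in>?B. ennreal (\<bar>u z - c\<bar> powr 1) \<partial>M) \<le> ennreal ((a' * t powr s) powr 1) * emeasure M ?B"
        using sharp_sigma_le_iff[OF zero_less_one real(1), of s u x] real a'(1) t by auto
      then have c: "(\<integral>\<^sup>+z\<in>?B. ennreal \<bar>u z - c\<bar> \<partial>M) \<le> ennreal (a' * t powr s) * emeasure M ?B"
        using a' by simp
      have intu: "integrable M (\<lambda>z. indicator ?B z * u z)"
        using u t by (auto simp: locally_integrable_def set_integrable_def)
      have int1: "integrable M (\<lambda>z. indicator ?B z * c)"
        using ball_not_top[of x t] by (simp add: less_top)
      have "(LINT z|M. indicator ?B z * (u z - c)) = (LINT z|M. indicator ?B z * u z) - (LINT z|M. indicator ?B z * c)"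
        using intu int1 by (simp add: right_diff_distrib)
      also have "\<dots> = (?m - c) * measure M ?B"
        using mB by (simp add: avg_def set_lebesgue_integral_def left_diff_distrib)
      finally have eq: "(LINT z|M. indicator ?B z * (u z - c)) = (?m - c) * measure M ?B" .
      have "ennreal (norm (LINT z|M. indicator ?B z * (u z - c))) \<le> (\<integral>\<^sup>+z. ennreal (norm (indicator ?B z * (u z - c))) \<partial>M)"
        using intu int1 by (intro integral_norm_bound_ennreal) (simp add: right_diff_distrib)
      also have "\<dots> = (\<integral>\<^sup>+z\<in>?B. ennreal \<bar>u z - c\<bar> \<partial>M)"
        by (intro nn_integral_cong) (auto simp: indicator_def)
      also note c
      finally have m: "ennreal (\<bar>?m - c\<bar> * measure M ?B) \<le> ennreal (a' * t powr s) * emeasure M ?B"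
        using mB by (simp add: eq abs_mult)
      have "(\<integral>\<^sup>+z\<in>?B. ennreal \<bar>u z - ?m\<bar> \<partial>M) \<le> (\<integral>\<^sup>+z. ennreal \<bar>u z - c\<bar> * indicator ?B z + ennreal \<bar>?m - c\<bar> * indicator ?B z \<partial>M)"
        by (intro nn_integral_mono) (auto simp: indicator_def ennreal_plus[symmetric] simp del: ennreal_plus)
      also have "\<dots> = (\<integral>\<^sup>+z\<in>?B. ennreal \<bar>u z - c\<bar> \<partial>M) + ennreal \<bar>?m - c\<bar> * emeasure M ?B"
        using um by (subst nn_integral_add) (auto simp: nn_integral_cmult_indicator)
      also have "ennreal \<bar>?m - c\<bar> * emeasure M ?B = ennreal (\<bar>?m - c\<bar> * measure M ?B)"
        by (simp add: emeasure_ball ennreal_mult)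
      also have "(\<integral>\<^sup>+z\<in>?B. ennreal \<bar>u z - c\<bar> \<partial>M) + ennreal (\<bar>?m - c\<bar> * measure M ?B) \<le>
          ennreal (a' * t powr s) * emeasure M ?B + ennreal (a' * t powr s) * emeasure M ?B"
        by (intro add_mono c m)
      also have "\<dots> = ennreal (2 * a' * t powr s) * emeasure M ?B"
        using a' by (simp add: distrib_right[symmetric] ennreal_plus[symmetric] mult.assoc del: ennreal_plus)
      finally show "(\<integral>\<^sup>+z\<in>?B. ennreal \<bar>u z - ?m\<bar> \<partial>M) \<le> ennreal (2 * a' * t powr s) * emeasure M ?B" .
    qed
    also have "2 * a' = 2 * a + e" by (simp add: a'_def)
    finally show ?thesis using e real(1) by simp
  qed
  then have "sharp M s u x \<le> ennreal (2 * a)" by (rule ennreal_le_epsilon)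
  then show ?thesis using real by (simp add: ennreal_mult)
qed (simp add: ennreal_mult_top)

text \<open>One point \<open>x0\<close> with a finite value suffices, since every ball lies in a
  ball about \<open>x0\<close>. Elements of the Hajlasz space are only measurable by definition, and
  this is how they qualify for \<open>C_space\<close>.\<close>

lemma locally_integrable_of_sharp_sigma:
  assumes u: "u \<in> borel_measurable M" and fin: "sharp_sigma M s 1 u x0 \<noteq> \<infinity>"
  shows "locally_integrable M u"
  unfolding locally_integrable_def
proof (intro conjI u allI impI)
  fix x and r :: real assume r: "0 < r"
  define R where "R = dist x0 x + r"
  have R: "0 < R" using r by (simp add: R_def add_nonneg_pos)
  obtain a where a: "sharp_sigma M s 1 u x0 = ennreal a" "0 \<le> a"
    using fin by (cases "sharp_sigma M s 1 u x0") auto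
  have "sharp_sigma M s 1 u x0 < ennreal (a + 1)" using a by (simp add: ennreal_less_iff)
  then obtain c where c: "(\<integral>\<^sup>+z\<in>ball x0 R. ennreal (\<bar>u z - c\<bar> powr 1) \<partial>M) \<le>
      ennreal (((a + 1) * R powr s) powr 1) * emeasure M (ball x0 R)"
    using sharp_sigma_less_ennrealE[OF zero_less_one _ R] by blast
  also have "\<dots> < \<infinity>" using ball_not_top[of x0 R] by (simp add: ennreal_mult_less_top less_top)
  finally have lt: "(\<integral>\<^sup>+z\<in>ball x0 R. ennreal (\<bar>u z - c\<bar> powr 1) \<partial>M) < \<infinity>" .
  have "integrable M (\<lambda>z. indicator (ball x0 R) z * (u z - c))"
  proof (rule integrableI_bounded)
    have "(\<integral>\<^sup>+z. ennreal (norm (indicator (ball x0 R) z * (u z - c))) \<partial>M) = (\<integral>\<^sup>+z\<in>ball x0 R. ennreal (\<bar>u z - c\<bar> powr 1) \<partial>M)"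
      by (intro nn_integral_cong) (auto simp: indicator_def)
    then show "(\<integral>\<^sup>+z. ennreal (norm (indicator (ball x0 R) z * (u z - c))) \<partial>M) < \<infinity>" using lt by simp
  qed (use u in measurable)
  moreover have "integrable M (\<lambda>z. indicator (ball x0 R) z * c)"
    using ball_not_top[of x0 R] by (simp add: less_top)
  ultimately have "integrable M (\<lambda>z. indicator (ball x0 R) z * (u z - c) + indicator (ball x0 R) z * c)"
    by (rule Bochner_Integration.integrable_add)
  then have "set_integrable M (ball x0 R) u"
    unfolding set_integrable_def by (simp add: distrib_left[symmetric])
  moreover have "ball x r \<subseteq> ball x0 R"
    using ball_minus_dist_subset[of x R x0] by (simp add: R_def)
  ultimately show "set_integrable M (ball x r) u" using set_integrable_subset[OF _ ball_in_M] by blast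
qed

lemma AE_imp_ex:
  assumes "AE x in M. P x"
  shows "\<exists>x. P x"
proof (rule ccontr)
  assume "\<not> ?thesis"
  then have "AE x in M. False" using assms by auto
  then have "emeasure M UNIV = 0" using AE_iff_measurable[of UNIV M "\<lambda>_. False"] borel_in_M[of UNIV] by auto
  then show False using ball_nonzero[of 1 undefined] emeasure_mono[of "ball undefined 1" UNIV M] borel_in_M[of UNIV] by auto
qed

end

theorem corollary3p1:
  fixes M :: "'a::metric_space measure" and C1 n s :: real and p :: ennreal
  assumes "doubling_metric_measure M C1 n"
    and "0 < s" and "0 < p"
  shows "(\<forall>\<sigma>::real. 0 < \<sigma> \<and> ennreal \<sigma> < p_star n p s \<longrightarrow>
            (\<forall>u\<in>borel_measurable M. u \<in> hajlasz_space M s p \<longleftrightarrow> sharp_sigma M s \<sigma> u \<in> Lp M p) \<and>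
            comparable_on (hajlasz_space M s p) (hajlasz_norm M s p)
              (\<lambda>u. Lp_norm M p (sharp_sigma M s \<sigma> u))) \<and>
         (ennreal (n / (n + s)) < p \<longrightarrow>
            C_space M s p = hajlasz_space M s p \<and>
            comparable_on (hajlasz_space M s p) (hajlasz_norm M s p) (C_norm M s p))"
proof -
  interpret doubling_metric_measure M C1 n by fact
  note s = \<open>0 < s\<close> and p = \<open>0 < p\<close>
  have fin: "ennreal a * x < \<infinity>" if "x < \<infinity>" for a x
    using that by (simp add: ennreal_mult_less_top)
  have mem_iff: "u \<in> hajlasz_space M s p \<longleftrightarrow> sharp_sigma M s \<sigma> u \<in> Lp M p"
    if \<sigma>: "0 < \<sigma>" and q: "ennreal (n * \<sigma> / (n + \<sigma> * s)) < p" and u: "u \<in> borel_measurable M" for \<sigma> u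
  proof -
    obtain C C' where "hajlasz_norm M s p u \<le> ennreal C * Lp_norm M p (sharp_sigma M s \<sigma> u)"
      "Lp_norm M p (sharp_sigma M s \<sigma> u) \<le> ennreal C' * hajlasz_norm M s p u"
      using bspec[OF _ u] hajlasz_norm_equiv_sharp_sigma[OF s \<sigma> p q] by blast
    then have "hajlasz_norm M s p u < \<infinity> \<longleftrightarrow> Lp_norm M p (sharp_sigma M s \<sigma> u) < \<infinity>"
      using fin le_less_trans by blast
    then show ?thesis
      using u sharp_sigma_measurable[OF s \<sigma> u] by (simp add: hajlasz_space_def Lp_def)
  qed
  have part1: "comparable_on (hajlasz_space M s p) (hajlasz_norm M s p) (\<lambda>u. Lp_norm M p (sharp_sigma M s \<sigma> u))"
    if \<sigma>: "0 < \<sigma>" and q: "ennreal (n * \<sigma> / (n + \<sigma> * s)) < p" for \<sigma>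
  proof -
    obtain C C' where C: "0 < C" "0 < C'" "\<forall>u\<in>borel_measurable M.
      hajlasz_norm M s p u \<le> ennreal C * Lp_norm M p (sharp_sigma M s \<sigma> u) \<and>
      Lp_norm M p (sharp_sigma M s \<sigma> u) \<le> ennreal C' * hajlasz_norm M s p u"
      using hajlasz_norm_equiv_sharp_sigma[OF s \<sigma> p q] by (elim exE conjE)
    then show ?thesis
      unfolding comparable_on_def
      by (intro exI[of _ "1 / C"] exI[of _ C']) (auto simp: hajlasz_space_def ennreal_mult_le_iff_swap)
  qed
  have part2: "C_space M s p = hajlasz_space M s p \<and> comparable_on (hajlasz_space M s p) (hajlasz_norm M s p) (C_norm M s p)"
    if "ennreal (n / (n + s)) < p"
  proof -
    \<comment> \<open>At \<sigma> = 1 the exponent q is n / (n + s), the threshold of part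
      (ii).\<close>
    have q: "ennreal (n * 1 / (n + 1 * s)) < p" using that by simp
    let ?S = "sharp_sigma M s 1"
    have le1: "Lp_norm M p (?S u) \<le> C_norm M s p u" if "u \<in> borel_measurable M" for u
      unfolding C_norm_def using sharp_sigma_measurable[OF s zero_less_one that] sharp_sigma_1_le_sharp
      by (intro Lp_norm_mono_AE[OF p]) auto
    have le2: "C_norm M s p u \<le> ennreal 2 * Lp_norm M p (?S u)" if u: "locally_integrable M u" for u
    proof -
      have um: "u \<in> borel_measurable M" using u by (simp add: locally_integrable_def)
      have "C_norm M s p u \<le> Lp_norm M p (\<lambda>x. ennreal 2 * ?S u x)"
        unfolding C_norm_def using sharp_measurable[OF s u] sharp_le_sharp_sigma_1[OF u]
        by (intro Lp_norm_mono_AE[OF p]) auto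
      also have "\<dots> \<le> ennreal 2 * Lp_norm M p (?S u)"
        by (rule Lp_norm_cmult_le[OF p sharp_sigma_measurable[OF s zero_less_one um]]) simp
      finally show ?thesis .
    qed
    have loc: "locally_integrable M u" if u: "u \<in> hajlasz_space M s p" for u
    proof -
      have um: "u \<in> borel_measurable M" using u by (simp add: hajlasz_space_def)
      have "?S u \<in> Lp M p" using mem_iff[OF zero_less_one q um] u by simp
      \<comment> \<open>Finiteness almost everywhere yields an actual point because the measure is
        not zero.\<close>
      then have "AE x in M. ?S u x \<noteq> \<infinity>"
        by (intro Lp_norm_finite_imp_AE[OF p]) (auto simp: Lp_def)
      then obtain x0 where "?S u x0 \<noteq> \<infinity>" using AE_imp_ex by blast
      then show ?thesis by (rule locally_integrable_of_sharp_sigma[OF um])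
    qed
    have "u \<in> C_space M s p \<longleftrightarrow> u \<in> hajlasz_space M s p" for u
    proof
      assume u: "u \<in> C_space M s p"
      then have um: "u \<in> borel_measurable M" by (simp add: C_space_def locally_integrable_def)
      have "C_norm M s p u < \<infinity>" using u by (simp add: C_space_def Lp_def C_norm_def)
      then have "?S u \<in> Lp M p"
        using le1[OF um] sharp_sigma_measurable[OF s zero_less_one um] by (auto simp: Lp_def intro: le_less_trans)
      then show "u \<in> hajlasz_space M s p" using mem_iff[OF zero_less_one q um] by simp
    next
      assume u: "u \<in> hajlasz_space M s p"
      then have um: "u \<in> borel_measurable M" by (simp add: hajlasz_space_def)
      have "?S u \<in> Lp M p" using mem_iff[OF zero_less_one q um] u by simp
      then have "C_norm M s p u < \<infinity>"
        using le_less_trans[OF le2[OF loc[OF u]] fin] by (simp add: Lp_def)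
      then show "u \<in> C_space M s p"
        using loc[OF u] sharp_measurable[OF s loc[OF u]] by (simp add: C_space_def Lp_def C_norm_def)
    qed
    moreover have "comparable_on (hajlasz_space M s p) (hajlasz_norm M s p) (C_norm M s p)"
    proof -
      obtain a b where ab: "0 < a" "0 < b"
        "\<And>u. u \<in> hajlasz_space M s p \<Longrightarrow> ennreal a * hajlasz_norm M s p u \<le> Lp_norm M p (?S u)"
        "\<And>u. u \<in> hajlasz_space M s p \<Longrightarrow> Lp_norm M p (?S u) \<le> ennreal b * hajlasz_norm M s p u"
        using part1[OF zero_less_one q] unfolding comparable_on_def by blast
      have "C_norm M s p u \<le> ennreal (2 * b) * hajlasz_norm M s p u" if u: "u \<in> hajlasz_space M s p" for u
      proof -
        have "C_norm M s p u \<le> ennreal 2 * (ennreal b * hajlasz_norm M s p u)"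
          by (rule order_trans[OF le2[OF loc[OF u]] mult_left_mono[OF ab(4)[OF u]]]) simp
        then show ?thesis using ab(2) by (simp add: ennreal_mult mult.assoc)
      qed
      moreover have "ennreal a * hajlasz_norm M s p u \<le> C_norm M s p u" if u: "u \<in> hajlasz_space M s p" for u
        using order_trans[OF ab(3)[OF u] le1] u by (simp add: hajlasz_space_def)
      ultimately show ?thesis
        unfolding comparable_on_def using ab(1,2) by (intro exI[of _ a] exI[of _ "2 * b"]) auto
    qed
    ultimately show ?thesis by blast
  qed
  show ?thesis
    using mem_iff part1 part2 exponent_below_p_star[OF s n_pos] by blast
qed

end
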